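(* Let $N\ge 3$, $p\in\left(1,\frac{N+2}{N-2}\right)$. Let $V\in C^1(\mathbb{R}^N,\mathbb{R})$ be bounded from above with $\inf_{\mathbb{R}^N}V=\alpha>0$, and let $J\in C^1(\mathbb{R}^N,\mathbb{R}^{N\times N})$ be bounded, with $J(x)$ symmetric for each $x$, and such that there is $\nu>0$ with $\langle J(x)\xi,\xi\rangle\ge\nu|\xi|^2$ for all $x\in\mathbb{R}^N$, $\xi\in\mathbb{R}^N\setminus\{0\}$. Define $\Gamma(z)=V(z)^{\frac{p+1}{p-1}-\frac N2}(\det J(z))^{1/2}$ for $z\in\mathbb{R}^N$. Let $z_0\in\mathbb{R}^N$, let $\varepsilon_j>0$ with $\varepsilon_j\to0$, and let $\{u_{\varepsilon_j}\}$ be a sequence such that $u_{\varepsilon_j}$ solves $$\begin{cases}-\varepsilon_j^2\,\mathrm{div}\big(J(x)\nabla u\big)+V(x)u=u^p&\text{in }\mathbb{R}^N,\\ u>0&\text{in }\mathbb{R}^N,\\ \lim_{|x|\to\infty}u(x)=0.\end{cases}$$ Suppose that for all $\eta>0$ there exist $\rho>0$ and $j_0>0$ such that for all $j\ge j_0$ and all points $x$ with $|x-z_0|\ge\varepsilon_j\rho$ one has $u_{\varepsilon_j}(x)\le\eta$. Then $z_0$ is a critical point of $\Gamma$.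
   Context: $\mathbb{R}^{N\times N}$ is the set of real $N\times N$ matrices; $\langle\cdot,\cdot\rangle$ is the Euclidean inner product. *)

theory Defs
  imports "HOL-Analysis.Analysis"
begin

text \<open>Class \<open>C\<^sup>1\<close> on the whole space: the Frechet derivative, as a map into the bounded
  linear functions with the operator norm, is continuous.\<close>

definition C1 :: "('a::real_normed_vector \<Rightarrow> 'b::real_normed_vector) \<Rightarrow> bool" where
  "C1 f \<longleftrightarrow> (\<exists>f'. (\<forall>x. (f has_derivative blinfun_apply (f' x)) (at x)) \<and> continuous_on UNIV f')"

definition grad :: "('a::real_inner \<Rightarrow> real) \<Rightarrow> 'a \<Rightarrow> 'a" where
  "grad f x = (THE D. GDERIV f x :> D)"

lemma grad_eq:
  assumes "GDERIV f x :> D"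
  shows "grad f x = D"
  unfolding grad_def
proof (rule the_equality)
  fix E assume "GDERIV f x :> E"
  then have "(\<lambda>h. inner h E) = (\<lambda>h. inner h D)"
    using assms unfolding gderiv_def by (rule has_derivative_unique)
  then have "\<forall>h. inner h E = inner h D"
    by (auto dest: fun_cong)
  then show "E = D"
    by (rule vector_eq_ldot[THEN iffD1])
qed (rule assms)

lemma C1_imp_GDERIV_grad:
  fixes f :: "'a::euclidean_space \<Rightarrow> real"
  assumes "C1 f"
  shows "GDERIV f x :> grad f x"
proof -
  obtain L where L: "(f has_derivative L) (at x)"
    using assms unfolding C1_def by blast
  have "bounded_linear L"
    using L by (rule has_derivative_bounded_linear)
  then have lin: "linear L"
    by (rule bounded_linear.linear)
  have "L = (\<lambda>h. inner h (adjoint L 1))"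
  proof
    fix h
    show "L h = inner h (adjoint L 1)"
      using adjoint_works[OF lin, of h 1] by (simp only: inner_real_def mult_1_right)
  qed
  with L have "GDERIV f x :> adjoint L 1"
    unfolding gderiv_def by simp
  with grad_eq[OF this] show ?thesis
    by simp
qed

definition compactly_supported :: "('a::topological_space \<Rightarrow> real) \<Rightarrow> bool" where
  "compactly_supported \<phi> \<longleftrightarrow> compact (closure {x. \<phi> x \<noteq> 0})"

text \<open>Solutions of
    \<open>- \<epsilon>\<^sup>2 div (J(x) \<nabla>u) + V(x) u = u\<^sup>p\<close> in \<open>\<real>\<^sup>N\<close>, \<open>u > 0\<close>, \<open>u(x) \<longlongrightarrow> 0\<close> as \<open>|x| \<longlongrightarrow> \<infinity>\<close>.
  The equation is understood in divergence form, i.e. tested against all \<open>\<phi>\<close> of class \<open>C\<^sup>1\<close> with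
  compact support. Every classical (\<open>C\<^sup>2\<close>) solution satisfies this, by integration by parts.
  For \<open>J\<close> and \<open>V\<close> merely of class \<open>C\<^sup>1\<close> a weak solution need not be \<open>C\<^sup>2\<close>; but, \<open>J\<close> being
  uniformly elliptic, a locally bounded weak solution that is locally in \<open>H\<^sup>1\<close> is of class \<open>C\<^sup>1\<close>
  by elliptic regularity, so requiring \<open>C1 u\<close> excludes neither kind of solution.\<close>

definition is_solution ::
  "real \<Rightarrow> (real^'n \<Rightarrow> real^'n^'n) \<Rightarrow> (real^'n \<Rightarrow> real) \<Rightarrow> real \<Rightarrow> (real^'n \<Rightarrow> real) \<Rightarrow> bool" where
  "is_solution \<epsilon> J V p u \<longleftrightarrow>
     C1 u \<and>
     (\<forall>\<phi>. C1 \<phi> \<and> compactly_supported \<phi> \<longrightarrow>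
        \<epsilon>\<^sup>2 * (LINT x|lborel. (J x *v grad u x) \<bullet> grad \<phi> x) + (LINT x|lborel. V x * u x * \<phi> x)
          = (LINT x|lborel. (u x powr p) * \<phi> x)) \<and>
     (\<forall>x. u x > 0) \<and>
     (u \<longlongrightarrow> 0) at_infinity"

definition Gamma_fun ::
  "(real^'n \<Rightarrow> real^'n^'n) \<Rightarrow> (real^'n \<Rightarrow> real) \<Rightarrow> real \<Rightarrow> real^'n \<Rightarrow> real" where
  "Gamma_fun J V p z =
     V z powr ((p + 1) / (p - 1) - real CARD('n) / 2) * sqrt (det (J z))"

definition critical_point :: "('a::real_inner \<Rightarrow> real) \<Rightarrow> 'a \<Rightarrow> bool" where
  "critical_point f z \<longleftrightarrow> GDERIV f z :> 0"

end

theory Submission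
  imports Defs
begin

text \<open>
  No limit profile, energy bound or regularity theory is needed. Testing the equation with
  difference quotients and using convexity of \<open>\<xi> \<mapsto> \<langle>J \<xi>, \<xi>\<rangle>\<close> gives a Pohozaev identity, with \<open>C\<^sup>1\<close>
  coefficients and weak solutions, for every compactly supported vector field. Away from \<open>z\<^sub>0\<close> the
  solutions are small, so by a Caccioppoli estimate the energy
  \<open>M = \<integral> \<epsilon>\<^sup>2 |\<nabla>u|\<^sup>2 + u\<^sup>2\<close> sits near \<open>z\<^sub>0\<close> up to an error \<open>O(\<epsilon>\<^sup>2) M\<close>, and coefficients may be
  frozen at \<open>z\<^sub>0\<close>. Put \<open>T = \<integral> \<epsilon>\<^sup>2 \<nabla>u \<otimes> \<nabla>u / M\<close> and \<open>B = \<integral> u\<^sup>2 / M\<close>. In the limit, linear vector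
  fields give \<open>J T = \<kappa> I\<close>, together with the equation tested by \<open>u\<close> this determines
  \<open>V B = \<kappa> (2 (p + 1) / (p - 1) - N)\<close> with \<open>\<kappa> \<noteq> 0\<close>, and constant fields give
  \<open>\<langle>\<partial>J, T\<rangle> + \<partial>V B = 0\<close>. Since \<open>T = \<kappa> J\<inverse>\<close>, Jacobi's formula turns the last identity into
  \<open>2 \<kappa> \<partial>(log \<Gamma>) = 0\<close> at \<open>z\<^sub>0\<close>.
\<close>

section \<open>Functions of class \<open>C\<^sup>1\<close>\<close>

text \<open>The obstacle is that nothing global is known at the outset: neither that the energy over
  the whole space is finite nor any bound on it uniform in \<epsilon>. Finiteness comes from
  boundedness of \<open>u\<close>: the mass of balls grows at most polynomially, and iterating the
  Caccioppoli estimate over quadrupled radii improves this to boundedness. Uniform bounds are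
  bypassed by dividing every identity by \<open>M\<close>: the pair \<open>(T, B)\<close> then lies
  in a fixed compact set, and the normalization \<open>T \<bullet> mat 1 + B = 1\<close> survives in
  the limit, which is what forces \<kappa> to be nonzero. The integral of
  \<open>u powr (p + 1)\<close> is not controlled by \<open>M\<close> near the concentration point;
  it enters the identities through a single scalar, which the equation tested by \<open>u\<close>
  eliminates. The order of choices matters. A tolerance \<omega> comes first, then a radius
  \<open>r\<close>, not scaled with \<epsilon>, such that the coefficients vary by at most \<omega>
  on the ball of radius \<open>8 * r\<close>, and last one index \<open>j\<close> for which the
  boundary terms are below \<omega> as well. Each \<omega> thus yields one pair
  \<open>(T, B)\<close>, and the limit is taken in \<omega>, inside a finite-dimensional
  space.\<close>

lemma C1_continuous:
  assumes "C1 f" shows "continuous_on UNIV f"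
  using assms unfolding C1_def
  by (metis continuous_at_imp_continuous_on has_derivative_continuous)

lemma C1_grad_derivative:
  fixes f :: "'a::euclidean_space \<Rightarrow> real"
  assumes "C1 f" shows "(f has_derivative (\<lambda>h. h \<bullet> grad f x)) (at x)"
  using C1_imp_GDERIV_grad[OF assms] by (simp add: gderiv_def)

lemma C1_grad_continuous:
  fixes f :: "'a::euclidean_space \<Rightarrow> real"
  assumes "C1 f" shows "continuous_on UNIV (grad f)"
proof -
  obtain f' where f': "\<And>x. (f has_derivative blinfun_apply (f' x)) (at x)" "continuous_on UNIV f'"
    using assms unfolding C1_def by blast
  have eq: "blinfun_apply (f' x) h = h \<bullet> grad f x" for x h
    using has_derivative_unique[OF f'(1) C1_grad_derivative[OF assms]] by metis
  have "grad f x = (\<Sum>b\<in>Basis. blinfun_apply (f' x) b *\<^sub>R b)" for x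
    unfolding eq by (subst euclidean_representation[symmetric]) (simp add: inner_commute)
  then have "grad f = (\<lambda>x. \<Sum>b\<in>Basis. blinfun_apply (f' x) b *\<^sub>R b)" by auto
  moreover have "continuous_on UNIV (\<lambda>x. \<Sum>b\<in>Basis. blinfun_apply (f' x) b *\<^sub>R b)"
    by (intro continuous_intros f'(2))
  ultimately show ?thesis by simp
qed

lemma grad_eqI:
  assumes "(f has_derivative (\<lambda>h. h \<bullet> G)) (at x)" shows "grad f x = G"
  using assms by (intro grad_eq) (simp add: gderiv_def)

text \<open>The closure properties below exhibit the gradient field once and read off from it both
  the class and the formula for \<open>grad\<close>.\<close>

lemma C1_gradI:
  fixes f :: "'a::euclidean_space \<Rightarrow> real"
  assumes "\<And>x. (f has_derivative (\<lambda>h. h \<bullet> G x)) (at x)" "continuous_on UNIV G"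
  shows "C1 f" "grad f = G"
proof -
  show "C1 f"
    unfolding C1_def
    by (rule exI[of _ "\<lambda>x. blinfun_inner_left (G x)"])
      (use assms in \<open>auto intro!: bounded_linear.continuous_on[OF bounded_linear_blinfun_inner_left]\<close>)
  show "grad f = G"
    using assms(1) by (auto intro: grad_eqI)
qed

lemma C1_mult:
  fixes f g :: "'a::euclidean_space \<Rightarrow> real"
  assumes "C1 f" "C1 g"
  shows "C1 (\<lambda>x. f x * g x)" "grad (\<lambda>x. f x * g x) = (\<lambda>x. f x *\<^sub>R grad g x + g x *\<^sub>R grad f x)"
proof -
  have 1: "((\<lambda>x. f x * g x) has_derivative (\<lambda>h. h \<bullet> (f x *\<^sub>R grad g x + g x *\<^sub>R grad f x))) (at x)" for x
    by (rule has_derivative_eq_rhs[OF has_derivative_mult[OF C1_grad_derivative[OF assms(1)] C1_grad_derivative[OF assms(2)]]])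
      (simp add: inner_add_right algebra_simps)
  have 2: "continuous_on UNIV (\<lambda>x. f x *\<^sub>R grad g x + g x *\<^sub>R grad f x)"
    by (intro continuous_intros C1_continuous C1_grad_continuous assms)
  show "C1 (\<lambda>x. f x * g x)" "grad (\<lambda>x. f x * g x) = (\<lambda>x. f x *\<^sub>R grad g x + g x *\<^sub>R grad f x)"
    using C1_gradI[OF 1 2] by auto
qed

lemma C1_add:
  fixes f g :: "'a::euclidean_space \<Rightarrow> real"
  assumes "C1 f" "C1 g"
  shows "C1 (\<lambda>x. f x + g x)" "grad (\<lambda>x. f x + g x) = (\<lambda>x. grad f x + grad g x)"
proof -
  have 1: "((\<lambda>x. f x + g x) has_derivative (\<lambda>h. h \<bullet> (grad f x + grad g x))) (at x)" for x
    by (rule has_derivative_eq_rhs[OF has_derivative_add[OF C1_grad_derivative[OF assms(1)] C1_grad_derivative[OF assms(2)]]])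
      (simp add: inner_add_right algebra_simps)
  have 2: "continuous_on UNIV (\<lambda>x. grad f x + grad g x)"
    by (intro continuous_intros C1_continuous C1_grad_continuous assms)
  show "C1 (\<lambda>x. f x + g x)" "grad (\<lambda>x. f x + g x) = (\<lambda>x. grad f x + grad g x)"
    using C1_gradI[OF 1 2] by auto
qed

lemma C1_cmult:
  fixes f :: "'a::euclidean_space \<Rightarrow> real"
  assumes "C1 f"
  shows "C1 (\<lambda>x. c * f x)" "grad (\<lambda>x. c * f x) = (\<lambda>x. c *\<^sub>R grad f x)"
proof -
  have 1: "((\<lambda>x. c * f x) has_derivative (\<lambda>h. h \<bullet> (c *\<^sub>R grad f x))) (at x)" for x
    by (rule has_derivative_eq_rhs[OF has_derivative_mult_right[OF C1_grad_derivative[OF assms(1)]]])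
      (simp add: algebra_simps)
  have 2: "continuous_on UNIV (\<lambda>x. c *\<^sub>R grad f x)"
    by (intro continuous_intros C1_grad_continuous assms)
  show "C1 (\<lambda>x. c * f x)" "grad (\<lambda>x. c * f x) = (\<lambda>x. c *\<^sub>R grad f x)"
    using C1_gradI[OF 1 2] by auto
qed

lemma C1_affine:
  fixes a z :: "'a::euclidean_space"
  shows "C1 (\<lambda>x. a \<bullet> (x - z))" "grad (\<lambda>x. a \<bullet> (x - z)) = (\<lambda>x. a)"
proof -
  have 1: "((\<lambda>x. a \<bullet> (x - z)) has_derivative (\<lambda>h. h \<bullet> a)) (at x)" for x
    by (auto intro!: derivative_eq_intros simp: inner_commute)
  show "C1 (\<lambda>x. a \<bullet> (x - z))" "grad (\<lambda>x. a \<bullet> (x - z)) = (\<lambda>x. a)"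
    using C1_gradI[OF 1 continuous_on_const] by auto
qed

lemma C1_translate:
  fixes f :: "'a::euclidean_space \<Rightarrow> real"
  assumes "C1 f"
  shows "C1 (\<lambda>x. f (x + a))" "grad (\<lambda>x. f (x + a)) = (\<lambda>x. grad f (x + a))"
proof -
  have 1: "((\<lambda>x. f (x + a)) has_derivative (\<lambda>h. h \<bullet> grad f (x + a))) (at x)" for x
  proof -
    have "((\<lambda>x. x + a) has_derivative (\<lambda>h. h)) (at x)" by (auto intro!: derivative_eq_intros)
    from has_derivative_compose[OF this C1_grad_derivative[OF assms]] show ?thesis by simp
  qed
  have 2: "continuous_on UNIV (\<lambda>x. grad f (x + a))"
    by (rule continuous_on_compose2[OF C1_grad_continuous[OF assms]]) (auto intro!: continuous_intros)
  show "C1 (\<lambda>x. f (x + a))" "grad (\<lambda>x. f (x + a)) = (\<lambda>x. grad f (x + a))"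
    using C1_gradI[OF 1 2] by auto
qed

lemma C1_powr:
  fixes f :: "'a::euclidean_space \<Rightarrow> real"
  assumes "C1 f" "\<And>x. f x > 0"
  shows "C1 (\<lambda>x. f x powr q)" "grad (\<lambda>x. f x powr q) = (\<lambda>x. (q * f x powr (q - 1)) *\<^sub>R grad f x)"
proof -
  have 1: "((\<lambda>x. f x powr q) has_derivative (\<lambda>h. h \<bullet> ((q * f x powr (q - 1)) *\<^sub>R grad f x))) (at x)" for x
    by (rule has_derivative_eq_rhs[OF has_derivative_powr[OF C1_grad_derivative[OF assms(1)] has_derivative_const]])
      (use assms(2)[of x] in \<open>auto simp: powr_diff field_simps\<close>)
  have 2: "continuous_on UNIV (\<lambda>x. (q * f x powr (q - 1)) *\<^sub>R grad f x)"
    using assms(2) by (intro continuous_intros C1_continuous[OF assms(1)] C1_grad_continuous[OF assms(1)]) (metis less_irrefl)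
  show "C1 (\<lambda>x. f x powr q)" "grad (\<lambda>x. f x powr q) = (\<lambda>x. (q * f x powr (q - 1)) *\<^sub>R grad f x)"
    using C1_gradI[OF 1 2] by auto
qed

lemma compactly_supportedI:
  fixes \<phi> :: "'a::euclidean_space \<Rightarrow> real"
  assumes "\<And>x. x \<notin> cball z R \<Longrightarrow> \<phi> x = 0"
  shows "compactly_supported \<phi>"
proof -
  have "closure {x. \<phi> x \<noteq> 0} \<subseteq> cball z R"
    by (rule closure_minimal) (use assms in \<open>blast, simp\<close>)
  then show ?thesis
    unfolding compactly_supported_def
    by (meson bounded_cball bounded_subset closed_closure compact_eq_bounded_closed)
qed

lemma grad_eq_0_outside:
  fixes f :: "'a::euclidean_space \<Rightarrow> real"
  assumes "\<And>x. x \<notin> cball z R \<Longrightarrow> f x = 0" "x \<notin> cball z R"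
  shows "grad f x = 0"
proof (rule grad_eqI)
  have "((\<lambda>x. 0) has_derivative (\<lambda>h. h \<bullet> 0)) (at x)" by simp
  then show "(f has_derivative (\<lambda>h. h \<bullet> 0)) (at x)"
    by (rule has_derivative_transform_within_open[where s="- cball z R"]) (use assms in auto)
qed

section \<open>Cutoff functions\<close>

text \<open>Test functions only have to be of class C1, so the squared positive part can take the
  place of a smooth bump function.\<close>

definition sq_pos :: "real \<Rightarrow> real" where "sq_pos t = (max 0 t)\<^sup>2"

lemma sq_pos_deriv: "(sq_pos has_real_derivative 2 * max 0 t) (at t)"
proof (cases "t = 0")
  case True
  have "((\<lambda>h. sq_pos h / h) \<longlongrightarrow> 0) (at 0)"
  proof (rule Lim_null_comparison)
    show "\<forall>\<^sub>F h in at 0. norm (sq_pos h / h) \<le> \<bar>h\<bar>"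
      by (rule always_eventually) (auto simp: sq_pos_def max_def power2_eq_square)
    show "(abs \<longlongrightarrow> 0) (at (0::real))" by (auto intro!: tendsto_eq_intros)
  qed
  then show ?thesis using True by (simp add: DERIV_def sq_pos_def)
next
  case False
  show ?thesis
  proof (cases "t > 0")
    case True
    have "((\<lambda>t. t\<^sup>2) has_real_derivative 2 * max 0 t) (at t)"
      using True by (auto intro!: derivative_eq_intros)
    then show ?thesis
      by (rule has_field_derivative_transform_within_open[where S="{0<..}"]) (use True in \<open>auto simp: sq_pos_def\<close>)
  next
    case F2: False
    have "((\<lambda>t. 0) has_real_derivative 2 * max 0 t) (at t)"
      using F2 by (auto intro!: derivative_eq_intros)
    then show ?thesis
      by (rule has_field_derivative_transform_within_open[where S="{..<0}"]) (use False F2 in \<open>auto simp: sq_pos_def\<close>)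
  qed
qed

lemma sq_pos_ge_1: "2 \<le> t \<Longrightarrow> 1 \<le> sq_pos (t - 1)"
  unfolding sq_pos_def by (rule one_le_power) auto

text \<open>The argument is quadratic in \<open>x\<close>, which keeps the function differentiable
  at \<open>z\<close>. Its value is 1 up to distance \<open>r\<close>, and it vanishes once the
  squared distance reaches \<open>2 * r\<^sup>2\<close>; the estimates round that radius up to
  \<open>2 * r\<close>.\<close>

definition cutoff :: "'a::euclidean_space \<Rightarrow> real \<Rightarrow> 'a \<Rightarrow> real" where
  "cutoff z r x = sq_pos (1 - sq_pos ((norm (x - z))\<^sup>2 / r\<^sup>2 - 1))"

definition cutoff_grad :: "'a::euclidean_space \<Rightarrow> real \<Rightarrow> 'a \<Rightarrow> 'a" where
  "cutoff_grad z r x = - (8 * max 0 (1 - sq_pos ((norm (x - z))\<^sup>2 / r\<^sup>2 - 1))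
      * max 0 ((norm (x - z))\<^sup>2 / r\<^sup>2 - 1) / r\<^sup>2) *\<^sub>R (x - z)"

lemma cutoff_C1: "C1 (cutoff z r)" "grad (cutoff z r) = cutoff_grad z r"
proof -
  have 1: "(cutoff z r has_derivative (\<lambda>h. h \<bullet> cutoff_grad z r x)) (at x)" for x :: 'a
  proof -
    let ?q = "\<lambda>x. (norm (x - z))\<^sup>2 / r\<^sup>2 - 1"
    have q: "(?q has_derivative (\<lambda>h. 2 * ((x - z) \<bullet> h) / r\<^sup>2)) (at x)"
      unfolding power2_norm_eq_inner
    proof -
      have "((\<lambda>x. inverse (r\<^sup>2) * ((x - z) \<bullet> (x - z)) - 1) has_derivative
          (\<lambda>h. inverse (r\<^sup>2) * (2 * ((x - z) \<bullet> h)))) (at x)"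
        by (auto intro!: derivative_eq_intros simp: inner_commute)
      then show "((\<lambda>x. (x - z) \<bullet> (x - z) / r\<^sup>2 - 1) has_derivative
          (\<lambda>h. 2 * ((x - z) \<bullet> h) / r\<^sup>2)) (at x)"
        by (simp add: divide_inverse mult_ac)
    qed
    have p: "((\<lambda>x. 1 - sq_pos (?q x)) has_derivative (\<lambda>h. - (2 * max 0 (?q x) * (2 * ((x - z) \<bullet> h) / r\<^sup>2)))) (at x)"
      by (rule has_derivative_eq_rhs[OF has_derivative_diff[OF has_derivative_const
         has_derivative_compose[OF q sq_pos_deriv[unfolded has_field_derivative_def]]]]) auto
    show ?thesis unfolding cutoff_def
      by (rule has_derivative_eq_rhs[OF has_derivative_compose[OF p sq_pos_deriv[unfolded has_field_derivative_def]]])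
        (auto simp: cutoff_grad_def inner_commute)
  qed
  have sc: "continuous_on UNIV sq_pos"
    unfolding sq_pos_def by (intro continuous_intros)
  have 2: "continuous_on UNIV (cutoff_grad z r)"
    unfolding cutoff_grad_def sq_pos_def power_divide[symmetric] divide_inverse
    by (intro continuous_intros)
  show "C1 (cutoff z r)" "grad (cutoff z r) = cutoff_grad z r"
    using C1_gradI[OF 1 2] by auto
qed

lemma cutoff_nonneg: "0 \<le> cutoff z r x"
  by (simp add: cutoff_def sq_pos_def)

lemma cutoff_le_1: "cutoff z r x \<le> 1"
  unfolding cutoff_def sq_pos_def by (rule power_le_one) auto

lemma cutoff_eq_1:
  assumes "r > 0" "norm (x - z) \<le> r" shows "cutoff z r x = 1"
proof -
  have "(norm (x - z))\<^sup>2 / r\<^sup>2 \<le> 1" using assms by (simp add: power_mono)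
  then show ?thesis by (simp add: cutoff_def sq_pos_def)
qed

lemma cutoff_eq_0:
  assumes "r > 0" "(norm (x - z))\<^sup>2 \<ge> 2 * r\<^sup>2" shows "cutoff z r x = 0" "cutoff_grad z r x = 0"
proof -
  have "(norm (x - z))\<^sup>2 / r\<^sup>2 \<ge> 2" using assms by (simp add: field_simps)
  then have "sq_pos ((norm (x - z))\<^sup>2 / r\<^sup>2 - 1) \<ge> 1" by (rule sq_pos_ge_1)
  then show "cutoff z r x = 0" "cutoff_grad z r x = 0"
    by (simp_all add: cutoff_def cutoff_grad_def sq_pos_def[of "1 - sq_pos t" for t])
qed

lemma cutoff_grad_eq_0:
  assumes "r > 0" "norm (x - z) \<le> r" shows "cutoff_grad z r x = 0"
proof -
  have "(norm (x - z))\<^sup>2 / r\<^sup>2 \<le> 1" using assms by (simp add: power_mono)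
  then show ?thesis by (simp add: cutoff_grad_def)
qed

lemma cutoff_outside:
  assumes "r > 0" "norm (x - z) \<ge> 2 * r" shows "cutoff z r x = 0" "cutoff_grad z r x = 0"
proof -
  have "(norm (x - z))\<^sup>2 \<ge> (2 * r)\<^sup>2" using assms by (intro power_mono) auto
  then have "(norm (x - z))\<^sup>2 \<ge> 2 * r\<^sup>2"
    using zero_le_power2[of r] by (auto simp: power_mult_distrib intro: order_trans[rotated])
  then show "cutoff z r x = 0" "cutoff_grad z r x = 0" using cutoff_eq_0 assms by auto
qed

lemma cutoff_support: "r > 0 \<Longrightarrow> x \<notin> cball z (2 * r) \<Longrightarrow> cutoff z r x = 0"
  by (rule cutoff_outside(1)) (auto simp: dist_norm norm_minus_commute)

lemma norm_cutoff_grad_le: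
  assumes "r > 0" shows "norm (cutoff_grad z r x) \<le> 16 / r"
proof (cases "norm (x - z) \<ge> 2 * r")
  case True then show ?thesis using cutoff_outside(2)[OF assms True] assms by simp
next
  case False
  let ?t = "(norm (x - z))\<^sup>2 / r\<^sup>2 - 1"
  \<comment> \<open>Where \<open>?t\<close> exceeds 1 the first factor is already zero, so the
    second one never contributes more than 1.\<close>
  have "max 0 (1 - sq_pos ?t) * max 0 ?t \<le> 1"
  proof (cases "?t \<le> 1")
    case True
    have "max 0 (1 - sq_pos ?t) \<le> 1" by (auto simp: sq_pos_def)
    then show ?thesis using True by (intro mult_le_one) auto
  next
    case False
    then have "sq_pos ?t \<ge> 1" by (intro sq_pos_ge_1) simp
    then show ?thesis by simp
  qed
  then have 1: "8 * (max 0 (1 - sq_pos ?t) * max 0 ?t) / r\<^sup>2 \<le> 8 / r\<^sup>2"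
    using assms by (simp add: divide_right_mono)
  have "norm (cutoff_grad z r x) = 8 * (max 0 (1 - sq_pos ?t) * max 0 ?t) / r\<^sup>2 * norm (x - z)"
    by (simp add: cutoff_grad_def abs_mult mult.assoc)
  also have "\<dots> \<le> 8 / r\<^sup>2 * (2 * r)"
    by (rule mult_mono[OF 1]) (use False in auto)
  also have "\<dots> = 16 / r" using assms by (simp add: power2_eq_square)
  finally show ?thesis .
qed

section \<open>Integration of compactly supported functions\<close>

lemma integrable_compact_support:
  fixes f :: "'a::euclidean_space \<Rightarrow> 'b::{banach,second_countable_topology}"
  assumes "continuous_on UNIV f" "\<And>x. x \<notin> cball z R \<Longrightarrow> f x = 0"
  shows "integrable lborel f"
proof -
  have "(\<lambda>x. indicator (cball z R) x *\<^sub>R f x) = f"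
    using assms(2) by (auto simp: indicator_def fun_eq_iff)
  moreover have "integrable lborel (\<lambda>x. indicator (cball z R) x *\<^sub>R f x)"
    by (intro borel_integrable_compact compact_cball continuous_on_subset[OF assms(1)]) auto
  ultimately show ?thesis by simp
qed

lemma integral_translate:
  fixes f :: "'a::euclidean_space \<Rightarrow> 'b::{banach,second_countable_topology}"
  assumes "continuous_on UNIV f"
  shows "(LINT x|lborel. f (x + a)) = (LINT x|lborel. f x)"
proof -
  have "(LINT x|lborel. f x) = (LINT x|distr lborel borel ((+) a). f x)"
    by (simp add: lborel_distr_plus)
  also have "\<dots> = (LINT x|lborel. f (a + x))"
    by (rule integral_distr) (use assms in \<open>auto intro: borel_measurable_continuous_onI\<close>)
  finally show ?thesis by (simp add: add.commute)
qed

lemma difference_quotient_bound: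
  fixes f :: "'a::real_normed_vector \<Rightarrow> 'b::real_normed_vector"
  assumes der: "\<And>x. (f has_derivative f' x) (at x)"
    and B: "\<And>s. 0 \<le> s \<Longrightarrow> s \<le> h \<Longrightarrow> norm (f' (x + s *\<^sub>R e) e) \<le> B"
    and "0 \<le> h"
  shows "norm (f (x + h *\<^sub>R e) - f x) \<le> B * h"
proof -
  have "((\<lambda>s. f (x + s *\<^sub>R e)) has_derivative (\<lambda>r. r *\<^sub>R f' (x + s *\<^sub>R e) e)) (at s within {0..h})" for s
  proof -
    have "((\<lambda>s. x + s *\<^sub>R e) has_derivative (\<lambda>r. r *\<^sub>R e)) (at s within {0..h})"
      by (auto intro!: derivative_eq_intros)
    from has_derivative_compose[OF this der]
    show ?thesis
      by (rule has_derivative_eq_rhs)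
        (simp add: linear_cmul[OF bounded_linear.linear[OF has_derivative_bounded_linear[OF der]]])
  qed
  then have "norm (f (x + h *\<^sub>R e) - f (x + 0 *\<^sub>R e)) \<le> B * norm (h - 0)"
    by (rule differentiable_bound[OF convex_real_interval(5)])
      (use B assms(3) in \<open>auto simp: onorm_scaleR_left onorm_id intro!: onorm_le\<close>)
  then show ?thesis using assms(3) by simp
qed

lemma difference_quotient_limit:
  fixes f :: "'a::real_normed_vector \<Rightarrow> 'b::real_normed_vector"
  assumes der: "(f has_derivative f') (at x)"
  shows "(\<lambda>n. real (Suc n) *\<^sub>R (f (x + inverse (real (Suc n)) *\<^sub>R e) - f x)) \<longlonglongrightarrow> f' e"
proof -
  let ?h = "\<lambda>n. inverse (real (Suc n))"
  have lin: "linear f'" using der by (intro bounded_linear.linear has_derivative_bounded_linear)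
  have "((\<lambda>s. f (x + s *\<^sub>R e)) has_derivative (\<lambda>r. r *\<^sub>R f' e)) (at 0)"
  proof -
    have "((\<lambda>s. x + s *\<^sub>R e) has_derivative (\<lambda>r. r *\<^sub>R e)) (at 0)"
      by (auto intro!: derivative_eq_intros)
    moreover have "(f has_derivative f') (at (x + 0 *\<^sub>R e))" using der by simp
    ultimately show ?thesis
      using has_derivative_compose[of "\<lambda>s. x + s *\<^sub>R e" "\<lambda>r. r *\<^sub>R e" 0 UNIV f f'] linear_cmul[OF lin] by simp
  qed
  then have "((\<lambda>h. norm (f (x + h *\<^sub>R e) - f x - h *\<^sub>R f' e) / norm h) \<longlongrightarrow> 0) (at 0)"
    by (simp add: has_derivative_at)
  moreover have "filterlim ?h (at 0) sequentially"
    by (simp add: filterlim_at LIMSEQ_inverse_real_of_nat del: of_nat_Suc)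
  ultimately have "(\<lambda>n. norm (f (x + ?h n *\<^sub>R e) - f x - ?h n *\<^sub>R f' e) / norm (?h n)) \<longlonglongrightarrow> 0"
    by (rule filterlim_compose)
  moreover have "norm (f (x + ?h n *\<^sub>R e) - f x - ?h n *\<^sub>R f' e) / norm (?h n)
      = norm (real (Suc n) *\<^sub>R (f (x + ?h n *\<^sub>R e) - f x) - f' e)" for n
  proof -
    have "real (Suc n) *\<^sub>R (f (x + ?h n *\<^sub>R e) - f x) - f' e
        = real (Suc n) *\<^sub>R (f (x + ?h n *\<^sub>R e) - f x - ?h n *\<^sub>R f' e)"
      by (simp add: scaleR_diff_right del: of_nat_Suc)
    then have "norm (real (Suc n) *\<^sub>R (f (x + ?h n *\<^sub>R e) - f x) - f' e)
        = real (Suc n) * norm (f (x + ?h n *\<^sub>R e) - f x - ?h n *\<^sub>R f' e)"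
      by (simp del: of_nat_Suc)
    then show ?thesis by (simp add: field_simps del: of_nat_Suc)
  qed
  ultimately show ?thesis
    by (simp only: tendsto_norm_zero_iff LIM_zero_iff)
qed

text \<open>Dominated convergence: the increments have length at most \<open>norm e\<close>, so all
  integrands live in one enlarged ball, on which the derivative is bounded. The disjunction in
  \<open>supp\<close> serves two uses: quotients of \<open>u\<close> against a compactly supported
  weight, and quotients of a compactly supported function against a weight without support
  condition.\<close>

lemma difference_quotient_integral:
  fixes f w :: "'a::euclidean_space \<Rightarrow> 'b::euclidean_space"
  assumes der: "\<And>x. (f has_derivative f' x) (at x)"
    and cont: "continuous_on UNIV (\<lambda>x. f' x e)"
    and w: "continuous_on UNIV w"
    and supp: "(\<forall>x. x \<notin> cball z R \<longrightarrow> f x = 0) \<or> (\<forall>x. x \<notin> cball z R \<longrightarrow> w x = 0)"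
  shows "(\<lambda>n. LINT x|lborel. (real (Suc n) *\<^sub>R (f (x + inverse (real (Suc n)) *\<^sub>R e) - f x)) \<bullet> w x)
    \<longlonglongrightarrow> (LINT x|lborel. f' x e \<bullet> w x)"
proof -
  let ?h = "\<lambda>n. inverse (real (Suc n))"
  let ?S = "cball z (R + norm e)" and ?S2 = "cball z (R + norm e + norm e)"
  have cf: "continuous_on UNIV f"
    using der by (meson continuous_at_imp_continuous_on has_derivative_continuous)
  have cw: "continuous_on UNIV (\<lambda>x. f' x e \<bullet> w x)"
    by (intro continuous_intros cont w)
  have "bounded ((\<lambda>x. f' x e) ` ?S2)"
    by (intro compact_imp_bounded compact_continuous_image continuous_on_subset[OF cont] compact_cball) auto
  then obtain B where B: "\<And>x. x \<in> ?S2 \<Longrightarrow> norm (f' x e) \<le> B"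
    unfolding bounded_iff by (metis imageI)
  have meas: "(\<lambda>x. (real (Suc n) *\<^sub>R (f (x + ?h n *\<^sub>R e) - f x)) \<bullet> w x) \<in> borel_measurable lborel" for n
  proof -
    have "continuous_on UNIV (\<lambda>x. f (x + ?h n *\<^sub>R e))"
      by (rule continuous_on_compose2[OF cf]) (auto intro!: continuous_intros)
    then have "continuous_on UNIV (\<lambda>x. (real (Suc n) *\<^sub>R (f (x + ?h n *\<^sub>R e) - f x)) \<bullet> w x)"
      by (intro continuous_intros cf w)
    then show ?thesis using borel_measurable_continuous_onI by auto
  qed
  show ?thesis
  proof (rule integral_dominated_convergence[where w="\<lambda>x. indicator ?S x *\<^sub>R (\<bar>B\<bar> * norm (w x))"])
    show "(\<lambda>x. f' x e \<bullet> w x) \<in> borel_measurable lborel"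
      using borel_measurable_continuous_onI[OF cw] by auto
    show "integrable lborel (\<lambda>x. indicator ?S x *\<^sub>R (\<bar>B\<bar> * norm (w x)))"
      by (intro borel_integrable_compact compact_cball continuous_intros continuous_on_subset[OF w]) auto
    show "AE x in lborel. (\<lambda>n. (real (Suc n) *\<^sub>R (f (x + ?h n *\<^sub>R e) - f x)) \<bullet> w x) \<longlonglongrightarrow> f' x e \<bullet> w x"
      by (intro AE_I2 tendsto_inner difference_quotient_limit[OF der] tendsto_const)
    show "AE x in lborel. norm ((real (Suc n) *\<^sub>R (f (x + ?h n *\<^sub>R e) - f x)) \<bullet> w x)
        \<le> indicator ?S x *\<^sub>R (\<bar>B\<bar> * norm (w x))" for n
    proof (intro AE_I2)
      fix x
      have h01: "0 \<le> ?h n" "?h n \<le> 1" by (auto simp: field_simps)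
      have step: "norm (s *\<^sub>R e) \<le> norm e" if "0 \<le> s" "s \<le> ?h n" for s
      proof -
        have "s \<le> 1" using that h01 by linarith
        then show ?thesis using that by (simp add: mult_left_le_one_le)
      qed
      show "norm ((real (Suc n) *\<^sub>R (f (x + ?h n *\<^sub>R e) - f x)) \<bullet> w x)
        \<le> indicator ?S x *\<^sub>R (\<bar>B\<bar> * norm (w x))"
      proof (cases "x \<in> ?S")
        case True
        have "norm (f' (x + s *\<^sub>R e) e) \<le> \<bar>B\<bar>" if "0 \<le> s" "s \<le> ?h n" for s
        proof -
          have "dist z (x + s *\<^sub>R e) \<le> dist z x + norm (s *\<^sub>R e)"
            by (metis dist_triangle dist_add_cancel dist_0_norm add.right_neutral)
          then have "x + s *\<^sub>R e \<in> ?S2" using step[OF that] True by auto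
          then show ?thesis using B by fastforce
        qed
        from difference_quotient_bound[OF der this h01(1)]
        have "norm (f (x + ?h n *\<^sub>R e) - f x) \<le> \<bar>B\<bar> * ?h n" .
        then have "real (Suc n) * norm (f (x + ?h n *\<^sub>R e) - f x) \<le> real (Suc n) * (\<bar>B\<bar> * ?h n)"
          by (rule mult_left_mono) auto
        then have "norm (real (Suc n) *\<^sub>R (f (x + ?h n *\<^sub>R e) - f x)) \<le> \<bar>B\<bar>"
          by (simp add: mult.left_commute del: of_nat_Suc)
        then have "norm (real (Suc n) *\<^sub>R (f (x + ?h n *\<^sub>R e) - f x)) * norm (w x) \<le> \<bar>B\<bar> * norm (w x)"
          by (rule mult_right_mono) auto
        with Cauchy_Schwarz_ineq2[of "real (Suc n) *\<^sub>R (f (x + ?h n *\<^sub>R e) - f x)" "w x"]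
        have "\<bar>(real (Suc n) *\<^sub>R (f (x + ?h n *\<^sub>R e) - f x)) \<bullet> w x\<bar> \<le> \<bar>B\<bar> * norm (w x)"
          by (rule order_trans)
        then show ?thesis using True by (simp del: of_nat_Suc inner_scaleR_left)
      next
        case False
        have "dist z x \<le> dist z (x + ?h n *\<^sub>R e) + norm (?h n *\<^sub>R e)"
          by (metis dist_triangle dist_add_cancel dist_0_norm add.right_neutral dist_commute)
        moreover have "R + norm e < dist z x" using False by simp
        ultimately have "R < dist z x" "R < dist z (x + ?h n *\<^sub>R e)"
          using step[OF h01(1) order_refl] norm_ge_zero[of e] by linarith+
        then show ?thesis using supp False by auto
      qed
    qed
  qed (rule meas)
qed

text \<open>By translation invariance of Lebesgue measure each difference quotient has integral 0,
  and the limit inherits this. It stands in for the divergence theorem.\<close>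

lemma integral_derivative_eq_0:
  fixes f :: "'a::euclidean_space \<Rightarrow> real"
  assumes f: "C1 f" and supp: "\<And>x. x \<notin> cball z R \<Longrightarrow> f x = 0"
  shows "(LINT x|lborel. e \<bullet> grad f x) = 0"
proof -
  have cf: "continuous_on UNIV f" using f by (rule C1_continuous)
  have "(\<lambda>n. LINT x|lborel. (real (Suc n) *\<^sub>R (f (x + inverse (real (Suc n)) *\<^sub>R e) - f x)) \<bullet> 1)
    \<longlonglongrightarrow> (LINT x|lborel. (e \<bullet> grad f x) \<bullet> 1)"
    by (rule difference_quotient_integral[OF C1_grad_derivative[OF f]])
      (use supp in \<open>auto intro!: continuous_intros C1_grad_continuous[OF f]\<close>)
  moreover have "(LINT x|lborel. (real (Suc n) *\<^sub>R (f (x + inverse (real (Suc n)) *\<^sub>R e) - f x)) \<bullet> 1) = 0" for n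
  proof -
    let ?a = "inverse (real (Suc n)) *\<^sub>R e"
    have i: "integrable lborel f" using integrable_compact_support[OF cf supp] .
    have "continuous_on UNIV (\<lambda>x. f (x + ?a))"
      by (rule continuous_on_compose2[OF cf]) (auto intro!: continuous_intros)
    then have i2: "integrable lborel (\<lambda>x. f (x + ?a))"
    proof (rule integrable_compact_support)
      fix x assume "x \<notin> cball (z - ?a) R"
      then have "x + ?a \<notin> cball z R" by (simp add: dist_norm algebra_simps)
      then show "f (x + ?a) = 0" by (rule supp)
    qed
    show ?thesis using i i2 integral_translate[OF cf, of ?a]
      by (simp del: of_nat_Suc)
  qed
  ultimately have "(\<lambda>n. 0) \<longlonglongrightarrow> (LINT x|lborel. e \<bullet> grad f x)" by simp
  then show ?thesis by (simp add: LIMSEQ_const_iff)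
qed

section \<open>The Pohozaev identity for weak solutions\<close>

text \<open>Matrices carry the Frobenius inner product, so \<open>A \<bullet> outer g\<close> is the
  quadratic form of \<open>A\<close> at \<open>g\<close>. Expressions quadratic in the gradient
  become linear in one matrix, which is what later allows them to be collected in the moment
  \<open>T\<close>.\<close>

definition outer :: "real^'n \<Rightarrow> real^'n^'n" where
  "outer g = (\<chi> i j. g $ i * g $ j)"

lemma inner_outer: "A \<bullet> outer g = (A *v g) \<bullet> g"
  by (simp add: outer_def inner_vec_def matrix_vector_mult_def sum_distrib_right sum_distrib_left mult_ac)

lemma norm_outer: "norm (outer g) = (norm g)\<^sup>2"
proof -
  have "outer g *v g = (g \<bullet> g) *\<^sub>R g"
    by (simp add: outer_def vec_eq_iff inner_vec_def matrix_vector_mult_def sum_distrib_right sum_distrib_left mult_ac)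
  then have "outer g \<bullet> outer g = (g \<bullet> g)\<^sup>2"
    by (simp add: inner_outer power2_eq_square)
  then show ?thesis by (simp add: norm_eq_sqrt_inner)
qed

lemma norm_matrix_vector_le: "norm (A *v x) \<le> norm A * norm (x :: real^'n)"
proof -
  have c: "(A *v x) $ i = A $ i \<bullet> x" for i
    by (simp add: matrix_vector_mult_def inner_vec_def)
  have "(norm (A *v x))\<^sup>2 = (\<Sum>i\<in>UNIV. (A $ i \<bullet> x)\<^sup>2)"
    unfolding power2_norm_eq_inner inner_vec_def[of "A *v x"] c by (simp add: power2_eq_square)
  also have "\<dots> \<le> (\<Sum>i\<in>UNIV. (A $ i \<bullet> A $ i) * (x \<bullet> x))"
    by (intro sum_mono Cauchy_Schwarz_ineq)
  also have "\<dots> = (norm A * norm x)\<^sup>2"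
    unfolding power_mult_distrib power2_norm_eq_inner inner_vec_def[of A] by (simp add: sum_distrib_right)
  finally show ?thesis by (rule power2_le_imp_le) simp
qed

lemma continuous_on_matrix_vector [continuous_intros]:
  fixes A :: "'a::topological_space \<Rightarrow> real^'n^'m"
  assumes "continuous_on S A" "continuous_on S v"
  shows "continuous_on S (\<lambda>x. A x *v v x)"
  unfolding matrix_vector_mult_def by (intro continuous_intros assms)

lemma continuous_on_outer [continuous_intros]:
  assumes "continuous_on S g" shows "continuous_on S (\<lambda>x. outer (g x))"
  unfolding outer_def by (intro continuous_intros assms)

lemma C1_frechet:
  assumes "C1 f"
  shows "(f has_derivative frechet_derivative f (at x)) (at x)"
    and "continuous_on UNIV (\<lambda>x. frechet_derivative f (at x) e)"
proof -
  obtain f' where f': "\<And>x. (f has_derivative blinfun_apply (f' x)) (at x)" "continuous_on UNIV f'"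
    using assms unfolding C1_def by blast
  have eq: "frechet_derivative f (at x) = blinfun_apply (f' x)" for x
    using frechet_derivative_at[OF f'(1)] by simp
  show "(f has_derivative frechet_derivative f (at x)) (at x)"
    using f'(1) by (simp add: eq)
  show "continuous_on UNIV (\<lambda>x. frechet_derivative f (at x) e)"
    unfolding eq by (intro continuous_intros f'(2))
qed

locale weak_solution =
  fixes V :: "real^'n \<Rightarrow> real" and J :: "real^'n \<Rightarrow> real^'n^'n"
    and p \<epsilon> :: real and u :: "real^'n \<Rightarrow> real"
  assumes V: "C1 V" and J: "C1 J"
    and sym: "transpose (J x) = J x"
    and psd: "0 \<le> (J x *v \<xi>) \<bullet> \<xi>"
    and p: "p > 1" and eps: "\<epsilon> > 0"
    and sol: "is_solution \<epsilon> J V p u"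
begin

abbreviation "g \<equiv> grad u"

abbreviation "DJ x \<equiv> frechet_derivative J (at x)"

lemma u_C1: "C1 u" and u_pos: "u x > 0"
  using sol by (auto simp: is_solution_def)

lemma u_powr_C1: "C1 (\<lambda>x. u x powr q)"
  by (rule C1_powr(1)[OF u_C1 u_pos])

lemma J_derivative: "(J has_derivative DJ x) (at x)"
  using C1_frechet(1)[OF J] .

lemma cont [continuous_intros]:
  "continuous_on UNIV u" "continuous_on UNIV g" "continuous_on UNIV V" "continuous_on UNIV (grad V)"
  "continuous_on UNIV J" "continuous_on UNIV (\<lambda>x. DJ x e)" "continuous_on UNIV (\<lambda>x. u x powr q)"
  using C1_continuous[OF u_C1] C1_grad_continuous[OF u_C1] C1_continuous[OF V] C1_grad_continuous[OF V]
    C1_continuous[OF J] C1_frechet(2)[OF J] C1_continuous[OF u_powr_C1]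
  by auto

lemma J_inner_commute: "(J x *v v) \<bullet> w = (J x *v w) \<bullet> v"
  by (metis dot_lmul_matrix inner_commute sym transpose_matrix_vector)

lemma weak:
  assumes "C1 \<phi>" "\<And>x. x \<notin> cball z R \<Longrightarrow> \<phi> x = 0"
  shows "\<epsilon>\<^sup>2 * (LINT x|lborel. (J x *v g x) \<bullet> grad \<phi> x) + (LINT x|lborel. V x * u x * \<phi> x)
          = (LINT x|lborel. (u x powr p) * \<phi> x)"
  using sol assms compactly_supportedI[of z R \<phi>] by (simp add: is_solution_def)

text \<open>What remains of the equation tested with \<open>\<psi> x * (e \<bullet> g x)\<close>
  after the derivative in direction \<open>e\<close> has been moved off the quadratic form of
  \<open>J\<close>, off \<open>u\<^sup>2\<close> and off the power of \<open>u\<close>. Only first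
  derivatives of \<open>u\<close> are left, so the expression makes sense for weak
  solutions.\<close>

definition poho :: "real^'n \<Rightarrow> (real^'n \<Rightarrow> real) \<Rightarrow> real^'n \<Rightarrow> real" where
  "poho e \<psi> x = \<epsilon>\<^sup>2 * (((J x *v g x) \<bullet> grad \<psi> x) * (e \<bullet> g x)
        - (e \<bullet> grad \<psi> x) * ((J x *v g x) \<bullet> g x) / 2 - \<psi> x * (DJ x e \<bullet> outer (g x)) / 2)
      - (u x)\<^sup>2 * (\<psi> x * (e \<bullet> grad V x) + V x * (e \<bullet> grad \<psi> x)) / 2
      + u x powr (p + 1) / (p + 1) * (e \<bullet> grad \<psi> x)"

lemma poho_integrable:
  assumes "C1 \<psi>" "\<And>x. x \<notin> cball z R \<Longrightarrow> \<psi> x = 0"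
  shows "integrable lborel (poho e \<psi>)"
proof (rule integrable_compact_support)
  show "continuous_on UNIV (poho e \<psi>)"
    unfolding poho_def using p
    by (auto intro!: continuous_intros C1_continuous[OF assms(1)] C1_grad_continuous[OF assms(1)])
  show "poho e \<psi> x = 0" if "x \<notin> cball z R" for x
    using grad_eq_0_outside[OF assms(2) that] assms(2)[OF that] by (simp add: poho_def)
qed

text \<open>The equation is tested with \<open>\<psi>(x) (u(x + t e) - u(x)) / t\<close>. As \<open>u\<close> has no second derivatives,
  \<open>\<psi> J \<nabla>u \<bullet> (\<nabla>u(x + t e) - \<nabla>u(x))\<close> is estimated from above by convexity of the quadratic form \<open>J\<close>;
  the resulting one-sided bound turns into an equality when it is also applied to \<open>- e\<close>.\<close>

lemma translation_inequality:
  assumes \<psi>: "C1 \<psi>" "\<And>x. x \<notin> cball z R \<Longrightarrow> \<psi> x = 0" "\<And>x. \<psi> x \<ge> 0"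
  shows "\<epsilon>\<^sup>2 / 2 * (LINT x|lborel. (\<psi> x *\<^sub>R DJ x e + (e \<bullet> grad \<psi> x) *\<^sub>R J x) \<bullet> outer (g x))
    \<le> \<epsilon>\<^sup>2 * (LINT x|lborel. ((J x *v g x) \<bullet> grad \<psi> x) * (e \<bullet> g x))
      + (LINT x|lborel. (V x * u x - u x powr p) * \<psi> x * (e \<bullet> g x))"
proof -
  let ?t = "\<lambda>n. inverse (real (Suc n))"
  let ?D = "\<lambda>n x. real (Suc n) * (u (x + ?t n *\<^sub>R e) - u x)"
  let ?F = "\<lambda>x. \<psi> x *\<^sub>R J x"
  let ?F' = "\<lambda>x e. \<psi> x *\<^sub>R DJ x e + (e \<bullet> grad \<psi> x) *\<^sub>R J x"
  let ?w1 = "\<lambda>x. (J x *v g x) \<bullet> grad \<psi> x"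
  let ?w2 = "\<lambda>x. (V x * u x - u x powr p) * \<psi> x"
  let ?a = "\<lambda>n. LINT x|lborel. \<psi> x * (real (Suc n) * ((J x *v g x) \<bullet> (g (x + ?t n *\<^sub>R e) - g x)))"
  let ?b = "\<lambda>n. LINT x|lborel. (real (Suc n) *\<^sub>R (?F (x + ?t n *\<^sub>R (- e)) - ?F x)) \<bullet> ((1/2) *\<^sub>R outer (g x))"
  note c\<psi> = C1_continuous[OF \<psi>(1)] C1_grad_continuous[OF \<psi>(1)]
  have g0: "grad \<psi> x = 0" if "x \<notin> cball z R" for x
    using grad_eq_0_outside[OF \<psi>(2) that] .
  have shift: "continuous_on UNIV (\<lambda>x. h (x + a))" if "continuous_on UNIV h" for h :: "real^'n \<Rightarrow> 'b::topological_space" and a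
    by (rule continuous_on_compose2[OF that]) (auto intro!: continuous_intros)
  have lim1: "(\<lambda>n. LINT x|lborel. ?D n x * ?w1 x) \<longlonglongrightarrow> (LINT x|lborel. (e \<bullet> g x) * ?w1 x)"
    using difference_quotient_integral[OF C1_grad_derivative[OF u_C1], where w="?w1" and z=z and R=R and e=e] g0
    by (force intro!: continuous_intros c\<psi>)
  have lim2: "(\<lambda>n. LINT x|lborel. ?D n x * ?w2 x) \<longlonglongrightarrow> (LINT x|lborel. (e \<bullet> g x) * ?w2 x)"
    using difference_quotient_integral[OF C1_grad_derivative[OF u_C1], where w="?w2" and z=z and R=R and e=e] \<psi>(2)
    by (force intro!: continuous_intros c\<psi>)
  have a_eq: "\<epsilon>\<^sup>2 * ?a n = - (\<epsilon>\<^sup>2 * (LINT x|lborel. ?D n x * ?w1 x) + (LINT x|lborel. ?D n x * ?w2 x))" for n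
  proof -
    let ?\<phi> = "\<lambda>x. \<psi> x * (real (Suc n) * (u (x + ?t n *\<^sub>R e) + (- 1) * u x))"
    have du: "C1 (\<lambda>x. u (x + ?t n *\<^sub>R e) + (- 1) * u x)"
      "grad (\<lambda>x. u (x + ?t n *\<^sub>R e) + (- 1) * u x) = (\<lambda>x. g (x + ?t n *\<^sub>R e) + (- 1) *\<^sub>R g x)"
      by (rule C1_add(1)[OF C1_translate(1)[OF u_C1] C1_cmult(1)[OF u_C1]])
        (simp only: C1_add(2)[OF C1_translate(1)[OF u_C1] C1_cmult(1)[OF u_C1]]
          C1_translate(2)[OF u_C1] C1_cmult(2)[OF u_C1])
    have dn: "C1 (\<lambda>x. real (Suc n) * (u (x + ?t n *\<^sub>R e) + (- 1) * u x))"
      "grad (\<lambda>x. real (Suc n) * (u (x + ?t n *\<^sub>R e) + (- 1) * u x))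
        = (\<lambda>x. real (Suc n) *\<^sub>R (g (x + ?t n *\<^sub>R e) + (- 1) *\<^sub>R g x))"
      by (rule C1_cmult(1)[OF du(1)]) (simp only: C1_cmult(2)[OF du(1)] du(2))
    have \<phi>: "C1 ?\<phi>" using C1_mult(1)[OF \<psi>(1) dn(1)] .
    have g\<phi>: "grad ?\<phi> = (\<lambda>x. \<psi> x *\<^sub>R (real (Suc n) *\<^sub>R (g (x + ?t n *\<^sub>R e) - g x)) + ?D n x *\<^sub>R grad \<psi> x)"
      unfolding C1_mult(2)[OF \<psi>(1) dn(1)] dn(2) by (simp del: of_nat_Suc)
    have w: "\<epsilon>\<^sup>2 * (LINT x|lborel. (J x *v g x) \<bullet> grad ?\<phi> x) + (LINT x|lborel. V x * u x * ?\<phi> x)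
          = (LINT x|lborel. (u x powr p) * ?\<phi> x)"
      by (rule weak[OF \<phi>, of z R]) (simp add: \<psi>(2))
    have "(LINT x|lborel. (J x *v g x) \<bullet> grad ?\<phi> x)
        = (LINT x|lborel. \<psi> x * (real (Suc n) * ((J x *v g x) \<bullet> (g (x + ?t n *\<^sub>R e) - g x))) + ?D n x * ?w1 x)"
      unfolding g\<phi> by (simp add: inner_add_right mult_ac del: of_nat_Suc)
    also have "\<dots> = ?a n + (LINT x|lborel. ?D n x * ?w1 x)"
      by (intro Bochner_Integration.integral_add integrable_compact_support[where z=z and R=R])
        (auto intro!: continuous_intros c\<psi> shift simp: \<psi>(2) g0 simp del: of_nat_Suc)
    finally have 1: "(LINT x|lborel. (J x *v g x) \<bullet> grad ?\<phi> x) = ?a n + (LINT x|lborel. ?D n x * ?w1 x)" .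
    have "(LINT x|lborel. V x * u x * ?\<phi> x) - (LINT x|lborel. (u x powr p) * ?\<phi> x)
        = (LINT x|lborel. V x * u x * ?\<phi> x - (u x powr p) * ?\<phi> x)"
      by (intro Bochner_Integration.integral_diff[symmetric] integrable_compact_support[where z=z and R=R])
        (auto intro!: continuous_intros c\<psi> shift simp: \<psi>(2) simp del: of_nat_Suc)
    also have "\<dots> = (LINT x|lborel. ?D n x * ?w2 x)"
      by (simp add: algebra_simps del: of_nat_Suc)
    finally show ?thesis using w 1 by (simp add: distrib_left)
  qed
  have dF: "(?F has_derivative ?F' x) (at x)" for x
    by (rule has_derivative_eq_rhs[OF has_derivative_scaleR[OF C1_grad_derivative[OF \<psi>(1)] J_derivative]]) simp
  have cF: "continuous_on UNIV ?F" by (intro continuous_intros c\<psi>)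
  have lim3: "?b \<longlonglongrightarrow> (LINT x|lborel. ?F' x (- e) \<bullet> ((1/2) *\<^sub>R outer (g x)))"
    by (rule difference_quotient_integral[OF dF, where z=z and R=R])
      (auto intro!: continuous_intros c\<psi> simp: \<psi>(2))
  have a_le_b: "?a n \<le> ?b n" for n
  proof -
    let ?G = "\<lambda>x. (real (Suc n) / 2) * (?F x \<bullet> outer (g (x + ?t n *\<^sub>R e)) - ?F x \<bullet> outer (g x))"
    have "?a n \<le> (LINT x|lborel. ?G x)"
    proof (rule integral_mono)
      show "integrable lborel (\<lambda>x. \<psi> x * (real (Suc n) * ((J x *v g x) \<bullet> (g (x + ?t n *\<^sub>R e) - g x))))"
        by (intro integrable_compact_support[where z=z and R=R] continuous_intros c\<psi> shift)
          (auto simp: \<psi>(2))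
      show "integrable lborel ?G"
        by (intro integrable_compact_support[where z=z and R=R] continuous_intros c\<psi> shift)
          (auto simp: \<psi>(2))
      fix x
      let ?h = "g (x + ?t n *\<^sub>R e)"
      have "0 \<le> (J x *v (?h - g x)) \<bullet> (?h - g x)" by (rule psd)
      then have "(J x *v g x) \<bullet> (?h - g x) \<le> (1/2) * ((J x *v ?h) \<bullet> ?h - (J x *v g x) \<bullet> g x)"
        using J_inner_commute[of x ?h "g x"]
        by (simp add: matrix_vector_mult_diff_distrib inner_diff_left inner_diff_right)
      then have "(real (Suc n) * \<psi> x) * ((J x *v g x) \<bullet> (?h - g x))
          \<le> (real (Suc n) * \<psi> x) * ((1/2) * ((J x *v ?h) \<bullet> ?h - (J x *v g x) \<bullet> g x))"
        using \<psi>(3) by (intro mult_left_mono) auto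
      then show "\<psi> x * (real (Suc n) * ((J x *v g x) \<bullet> (?h - g x))) \<le> ?G x"
        by (simp add: inner_outer[of "J x"] algebra_simps del: of_nat_Suc)
    qed
    also have "\<dots> = (real (Suc n) / 2) * ((LINT x|lborel. ?F x \<bullet> outer (g (x + ?t n *\<^sub>R e))) - (LINT x|lborel. ?F x \<bullet> outer (g x)))"
    proof -
      have "integrable lborel (\<lambda>x. ?F x \<bullet> outer (g (x + ?t n *\<^sub>R e)))" "integrable lborel (\<lambda>x. ?F x \<bullet> outer (g x))"
        by (intro integrable_compact_support[where z=z and R=R] continuous_intros c\<psi> shift, simp add: \<psi>(2))+
      then show ?thesis by (simp del: of_nat_Suc)
    qed
    \<comment> \<open>A discrete integration by parts: translating the variable moves the increment
      from the gradient of \<open>u\<close>, which is merely continuous, to \<open>?F\<close>, which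
      is of class C1. The direction changes to \<open>- e\<close>.\<close>
    also have "(LINT x|lborel. ?F x \<bullet> outer (g (x + ?t n *\<^sub>R e))) = (LINT x|lborel. ?F (x + ?t n *\<^sub>R (- e)) \<bullet> outer (g x))"
    proof -
      have "continuous_on UNIV (\<lambda>x. ?F (x + ?t n *\<^sub>R (- e)) \<bullet> outer (g x))"
        by (intro continuous_intros shift cF)
      from integral_translate[OF this, of "?t n *\<^sub>R e"] show ?thesis by (simp del: of_nat_Suc)
    qed
    also have "(real (Suc n) / 2) * (\<dots> - (LINT x|lborel. ?F x \<bullet> outer (g x))) = ?b n"
    proof -
      have 1: "integrable lborel (\<lambda>x. ?F (x + ?t n *\<^sub>R (- e)) \<bullet> outer (g x))"
      proof (rule integrable_compact_support)
        show "continuous_on UNIV (\<lambda>x. ?F (x + ?t n *\<^sub>R (- e)) \<bullet> outer (g x))"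
          by (intro continuous_intros shift cF)
        fix x assume "x \<notin> cball (z + ?t n *\<^sub>R e) R"
        then have "x + ?t n *\<^sub>R (- e) \<notin> cball z R" by (simp add: dist_norm algebra_simps)
        then show "?F (x + ?t n *\<^sub>R (- e)) \<bullet> outer (g x) = 0" by (simp add: \<psi>(2) del: of_nat_Suc)
      qed
      have 2: "integrable lborel (\<lambda>x. ?F x \<bullet> outer (g x))"
        by (intro integrable_compact_support[where z=z and R=R] continuous_intros c\<psi>) (simp add: \<psi>(2))
      have "?b n = (LINT x|lborel. (real (Suc n) / 2) * (?F (x + ?t n *\<^sub>R (- e)) \<bullet> outer (g x) - ?F x \<bullet> outer (g x)))"
        by (intro Bochner_Integration.integral_cong refl) (simp add: inner_diff_left algebra_simps del: of_nat_Suc)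
      then show ?thesis using 1 2 by (simp del: of_nat_Suc inner_scaleR_left)
    qed
    finally show ?thesis .
  qed
  have "- (\<epsilon>\<^sup>2 * (LINT x|lborel. (e \<bullet> g x) * ?w1 x) + (LINT x|lborel. (e \<bullet> g x) * ?w2 x))
     \<le> \<epsilon>\<^sup>2 * (LINT x|lborel. ?F' x (- e) \<bullet> ((1/2) *\<^sub>R outer (g x)))"
  proof (rule LIMSEQ_le)
    show "(\<lambda>n. \<epsilon>\<^sup>2 * ?a n) \<longlonglongrightarrow> - (\<epsilon>\<^sup>2 * (LINT x|lborel. (e \<bullet> g x) * ?w1 x) + (LINT x|lborel. (e \<bullet> g x) * ?w2 x))"
      unfolding a_eq by (intro tendsto_intros lim1 lim2)
    show "(\<lambda>n. \<epsilon>\<^sup>2 * ?b n) \<longlonglongrightarrow> \<epsilon>\<^sup>2 * (LINT x|lborel. ?F' x (- e) \<bullet> ((1/2) *\<^sub>R outer (g x)))"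
      by (intro tendsto_intros lim3)
    show "\<exists>N. \<forall>n\<ge>N. \<epsilon>\<^sup>2 * ?a n \<le> \<epsilon>\<^sup>2 * ?b n"
      using a_le_b by (intro exI allI impI mult_left_mono) auto
  qed
  moreover have "(LINT x|lborel. ?F' x (- e) \<bullet> ((1/2) *\<^sub>R outer (g x))) = - (1/2) * (LINT x|lborel. ?F' x e \<bullet> outer (g x))"
  proof -
    have "?F' x (- e) \<bullet> ((1/2) *\<^sub>R outer (g x)) = - (1/2) * (?F' x e \<bullet> outer (g x))" for x
      using linear_neg[OF bounded_linear.linear[OF has_derivative_bounded_linear[OF J_derivative]], of x e]
      by (simp add: inner_add_left algebra_simps)
    then show ?thesis by (simp only: integral_mult_right_zero)
  qed
  ultimately show ?thesis by (simp add: mult_ac)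
qed

lemma pohozaev_nonneg:
  assumes \<psi>: "C1 \<psi>" "\<And>x. x \<notin> cball z R \<Longrightarrow> \<psi> x = 0" "\<And>x. \<psi> x \<ge> 0"
  shows "(LINT x|lborel. poho e \<psi> x) = 0"
proof -
  let ?S = "\<lambda>e x. (\<psi> x *\<^sub>R DJ x e + (e \<bullet> grad \<psi> x) *\<^sub>R J x) \<bullet> outer (g x)"
  let ?L1 = "\<lambda>e x. ((J x *v g x) \<bullet> grad \<psi> x) * (e \<bullet> g x)"
  let ?L2 = "\<lambda>e x. (V x * u x - u x powr p) * \<psi> x * (e \<bullet> g x)"
  \<comment> \<open>A primitive in \<open>u\<close> of the zero order terms, times the weight. Its
    derivative in direction \<open>e\<close> has integral 0; subtracting it cancels
    \<open>?L2 e\<close> and leaves the terms of \<open>poho\<close> in which \<open>V\<close> and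
    \<psi> are differentiated.\<close>
  let ?H = "\<lambda>x. \<psi> x * ((1/2) * (V x * (u x * u x)) + (- 1 / (p + 1)) * u x powr (p + 1))"
  note c\<psi> = C1_continuous[OF \<psi>(1)] C1_grad_continuous[OF \<psi>(1)]
  have g0: "grad \<psi> x = 0" if "x \<notin> cball z R" for x
    using grad_eq_0_outside[OF \<psi>(2) that] .
  have neg: "DJ x (- e) = - DJ x e" for x
    using linear_neg[OF bounded_linear.linear[OF has_derivative_bounded_linear[OF J_derivative]]] .
  have "?S (- e) x = - ?S e x" "?L1 (- e) x = - ?L1 e x" "?L2 (- e) x = - ?L2 e x" for x
    by (simp_all add: neg inner_add_left algebra_simps)
  note odd = this
  have TI: "\<epsilon>\<^sup>2 / 2 * (LINT x|lborel. ?S e x) \<le> \<epsilon>\<^sup>2 * (LINT x|lborel. ?L1 e x) + (LINT x|lborel. ?L2 e x)" for e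
    by (rule translation_inequality[OF \<psi>(1) _ \<psi>(3), where z=z and R=R]) (rule \<psi>(2))
  have "- (\<epsilon>\<^sup>2 / 2 * (LINT x|lborel. ?S e x)) \<le> - (\<epsilon>\<^sup>2 * (LINT x|lborel. ?L1 e x) + (LINT x|lborel. ?L2 e x))"
    using TI[of "- e"] unfolding odd by simp
  with TI[of e]
  have eq: "\<epsilon>\<^sup>2 * (LINT x|lborel. ?L1 e x) + (LINT x|lborel. ?L2 e x) - \<epsilon>\<^sup>2 / 2 * (LINT x|lborel. ?S e x) = 0"
    by linarith
  have uu: "C1 (\<lambda>x. u x * u x)" "grad (\<lambda>x. u x * u x) = (\<lambda>x. u x *\<^sub>R g x + u x *\<^sub>R g x)"
    using C1_mult[OF u_C1 u_C1] .
  have Vuu: "C1 (\<lambda>x. V x * (u x * u x))"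
    "grad (\<lambda>x. V x * (u x * u x)) = (\<lambda>x. V x *\<^sub>R (u x *\<^sub>R g x + u x *\<^sub>R g x) + (u x * u x) *\<^sub>R grad V x)"
    by (rule C1_mult(1)[OF V uu(1)]) (simp only: C1_mult(2)[OF V uu(1)] uu(2))
  have Q: "C1 (\<lambda>x. (1/2) * (V x * (u x * u x)) + (- 1 / (p + 1)) * u x powr (p + 1))"
    "grad (\<lambda>x. (1/2) * (V x * (u x * u x)) + (- 1 / (p + 1)) * u x powr (p + 1))
      = (\<lambda>x. (1/2) *\<^sub>R (V x *\<^sub>R (u x *\<^sub>R g x + u x *\<^sub>R g x) + (u x * u x) *\<^sub>R grad V x)
          + (- 1 / (p + 1)) *\<^sub>R (((p + 1) * u x powr (p + 1 - 1)) *\<^sub>R g x))"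
    by (rule C1_add(1)[OF C1_cmult(1)[OF Vuu(1)] C1_cmult(1)[OF u_powr_C1]])
      (simp only: C1_add(2)[OF C1_cmult(1)[OF Vuu(1)] C1_cmult(1)[OF u_powr_C1]] C1_cmult(2)[OF Vuu(1)]
      C1_cmult(2)[OF u_powr_C1] Vuu(2) C1_powr(2)[OF u_C1 u_pos])
  have H: "C1 ?H" "grad ?H = (\<lambda>x. \<psi> x *\<^sub>R ((1/2) *\<^sub>R (V x *\<^sub>R (u x *\<^sub>R g x + u x *\<^sub>R g x) + (u x * u x) *\<^sub>R grad V x)
          + (- 1 / (p + 1)) *\<^sub>R (((p + 1) * u x powr (p + 1 - 1)) *\<^sub>R g x))
      + ((1/2) * (V x * (u x * u x)) + (- 1 / (p + 1)) * u x powr (p + 1)) *\<^sub>R grad \<psi> x)"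
    by (rule C1_mult(1)[OF \<psi>(1) Q(1)]) (simp only: C1_mult(2)[OF \<psi>(1) Q(1)] Q(2))
  have IH: "(LINT x|lborel. e \<bullet> grad ?H x) = 0"
    by (rule integral_derivative_eq_0[OF H(1), of z R]) (simp add: \<psi>(2))
  have iH: "integrable lborel (\<lambda>x. e \<bullet> grad ?H x)"
    by (intro integrable_compact_support[where z=z and R=R] continuous_intros C1_grad_continuous[OF H(1)])
      (simp only: H(2) \<psi>(2) g0 not_False_eq_True, simp)
  have iS: "integrable lborel (?S e)" "integrable lborel (?L1 e)" "integrable lborel (?L2 e)"
    by (intro integrable_compact_support[where z=z and R=R] continuous_intros c\<psi>; simp add: \<psi>(2) g0)+
  have "poho e \<psi> x = \<epsilon>\<^sup>2 * ?L1 e x + ?L2 e x - \<epsilon>\<^sup>2 / 2 * ?S e x - e \<bullet> grad ?H x" for x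
  proof -
    have "p + 1 \<noteq> 0" using p by simp
    then show ?thesis
      unfolding poho_def H(2) inner_add_left inner_add_right inner_scaleR_left inner_scaleR_right inner_outer[of "J x"]
      by (simp add: divide_simps power2_eq_square) (simp add: algebra_simps)
  qed
  then have "(LINT x|lborel. poho e \<psi> x)
      = (LINT x|lborel. \<epsilon>\<^sup>2 * ?L1 e x + ?L2 e x - \<epsilon>\<^sup>2 / 2 * ?S e x - e \<bullet> grad ?H x)" by presburger
  also have "\<dots> = \<epsilon>\<^sup>2 * (LINT x|lborel. ?L1 e x) + (LINT x|lborel. ?L2 e x) - \<epsilon>\<^sup>2 / 2 * (LINT x|lborel. ?S e x) - (LINT x|lborel. e \<bullet> grad ?H x)"
    using iS iH by (simp only: Bochner_Integration.integral_add Bochner_Integration.integral_diff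
       Bochner_Integration.integrable_add Bochner_Integration.integrable_diff integrable_mult_right integral_mult_right_zero)
  finally show ?thesis using eq IH by simp
qed

text \<open>Linear vector fields lead to weights that change sign. Since \<open>poho\<close> is
  linear in the weight, a large multiple of a cutoff equal to 1 on the support ball may be added to
  make the weight nonnegative; the identity holds for the sum and for the cutoff, hence for the
  difference.\<close>

lemma pohozaev:
  assumes \<psi>: "C1 \<psi>" "\<And>x. x \<notin> cball z R \<Longrightarrow> \<psi> x = 0" and R: "R > 0"
  shows "(LINT x|lborel. poho e \<psi> x) = 0"
proof -
  have "bounded (\<psi> ` cball z R)"
    by (intro compact_imp_bounded compact_continuous_image continuous_on_subset[OF C1_continuous[OF \<psi>(1)]] compact_cball) auto
  then obtain C where C: "\<And>x. x \<in> cball z R \<Longrightarrow> \<bar>\<psi> x\<bar> \<le> C"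
    unfolding bounded_iff real_norm_def by (metis imageI)
  let ?\<chi> = "cutoff z R" and ?\<psi>' = "\<lambda>x. \<psi> x + C * cutoff z R x"
  have C0: "C \<ge> 0" using C[of z] R by simp
  have \<chi>: "C1 ?\<chi>" "\<And>x. x \<notin> cball z (2 * R) \<Longrightarrow> ?\<chi> x = 0" "\<And>x. ?\<chi> x \<ge> 0"
    by (rule cutoff_C1(1)) (use R in \<open>auto intro: cutoff_support cutoff_nonneg\<close>)
  have C\<chi>: "C1 (\<lambda>x. C * ?\<chi> x)" "grad (\<lambda>x. C * ?\<chi> x) = (\<lambda>x. C *\<^sub>R grad ?\<chi> x)"
    by (rule C1_cmult(1)[OF \<chi>(1)]) (rule C1_cmult(2)[OF \<chi>(1)])
  have \<psi>': "C1 ?\<psi>'" "grad ?\<psi>' = (\<lambda>x. grad \<psi> x + C *\<^sub>R grad ?\<chi> x)"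
    by (rule C1_add(1)[OF \<psi>(1) C\<chi>(1)]) (simp only: C1_add(2)[OF \<psi>(1) C\<chi>(1)] C\<chi>(2))
  have \<psi>2: "\<psi> x = 0" if "x \<notin> cball z (2 * R)" for x
    by (rule \<psi>(2)) (use that R in auto)
  have pos: "?\<psi>' x \<ge> 0" for x
  proof (cases "x \<in> cball z R")
    case True
    then have "?\<chi> x = 1" by (intro cutoff_eq_1[OF R]) (simp add: dist_norm norm_minus_commute)
    then show ?thesis using C[OF True] by auto
  next
    case False then show ?thesis using \<psi>(2)[OF False] C0 cutoff_nonneg[of z R x] by simp
  qed
  have lin: "poho e ?\<psi>' x = poho e \<psi> x + C * poho e ?\<chi> x" for x
    unfolding poho_def \<psi>'(2)
    by (simp add: inner_add_right algebra_simps add_divide_distrib diff_divide_distrib)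
  have "0 = (LINT x|lborel. poho e ?\<psi>' x)"
    by (rule pohozaev_nonneg[OF \<psi>'(1) _ pos, where z=z and R="2 * R", symmetric]) (simp add: \<psi>2 \<chi>(2))
  also have "\<dots> = (LINT x|lborel. poho e \<psi> x) + C * (LINT x|lborel. poho e ?\<chi> x)"
  proof -
    have "integrable lborel (poho e \<psi>)" "integrable lborel (poho e ?\<chi>)"
      by (rule poho_integrable[OF \<psi>(1)], rule \<psi>(2), assumption)
        (rule poho_integrable[OF \<chi>(1)], rule \<chi>(2))
    then show ?thesis
      by (simp only: lin Bochner_Integration.integral_add integrable_mult_right integral_mult_right_zero)
  qed
  also have "(LINT x|lborel. poho e ?\<chi> x) = 0"
    by (rule pohozaev_nonneg[OF \<chi>(1) _ \<chi>(3), where z=z and R="2 * R"]) (rule \<chi>(2))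
  finally show ?thesis by simp
qed

end

section \<open>Decay away from the concentration point\<close>

lemma cutoff_le_cutoff:
  assumes "r > 0" "2 * r \<le> s" shows "cutoff z r x \<le> cutoff z s x"
proof (cases "norm (x - z) \<le> s")
  case True
  then show ?thesis using cutoff_eq_1[of s x z] cutoff_le_1[of z r x] assms by simp
next
  case False
  then show ?thesis using cutoff_outside(1)[of r x z] cutoff_nonneg[of z s x] assms by simp
qed

text \<open>Bounding by a wider cutoff instead of the indicator of a ball lets the Caccioppoli
  estimate close on integrals of the same kind, so that it can be iterated.\<close>

lemma norm_cutoff_grad_sq_le:
  assumes "r > 0" shows "(norm (cutoff_grad z r x))\<^sup>2 \<le> 256 / r\<^sup>2 * cutoff z (2 * r) x"
proof (cases "norm (x - z) \<le> 2 * r")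
  case True
  have "(norm (cutoff_grad z r x))\<^sup>2 \<le> (16 / r)\<^sup>2"
    by (rule power_mono[OF norm_cutoff_grad_le[OF assms]]) simp
  then show ?thesis using cutoff_eq_1[of "2 * r" x z] True assms by (simp add: power_divide)
next
  case False
  then show ?thesis using cutoff_outside(2)[of r x z] cutoff_nonneg[of z "2 * r" x] assms by simp
qed

text \<open>Passing from \<open>R\<close> to \<open>4 * R\<close> multiplies the growth bound by
  \<open>4 ^ N\<close>, while the step supplies the factor \<open>1 / (2 * 4 ^ N)\<close>. Each
  iteration therefore halves the remainder, and the constants sum to at most
  \<open>2 * A\<close>.\<close>

lemma bounded_of_growth_iteration:
  fixes a :: "real \<Rightarrow> real"
  assumes "A \<ge> 0" "R0 > 0"
    and step: "\<And>R. R \<ge> R0 \<Longrightarrow> a R \<le> A + 1 / (2 * 4 ^ N) * a (4 * R)"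
    and growth: "\<And>R. R \<ge> R0 \<Longrightarrow> a R \<le> C * R ^ N"
    and R: "R \<ge> R0"
  shows "a R \<le> 2 * A"
proof -
  let ?q = "1 / (2 * 4 ^ N) :: real"
  have q: "?q \<le> 1 / 2" "?q \<ge> 0" by (simp_all add: field_simps)
  have it: "a R \<le> 2 * A + ?q ^ k * a (4 ^ k * R)" if "R \<ge> R0" for k R
    using that
  proof (induction k arbitrary: R)
    case 0 then show ?case using assms(1) by simp
  next
    case (Suc k)
    have "a R \<le> A + ?q * a (4 * R)" by (rule step[OF Suc.prems])
    also have "\<dots> \<le> A + ?q * (2 * A + ?q ^ k * a (4 ^ k * (4 * R)))"
      using Suc.IH[of "4 * R"] Suc.prems assms(2) q by (intro add_left_mono mult_left_mono) auto
    also have "\<dots> = A + ?q * (2 * A) + ?q ^ Suc k * a (4 ^ Suc k * R)"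
      by (simp only: distrib_left power_Suc mult_ac)
    also have "?q * (2 * A) \<le> 1 / 2 * (2 * A)"
      by (rule mult_right_mono[OF q(1)]) (use assms in auto)
    finally show ?case by simp
  qed
  have le: "a R \<le> 2 * A + (C * R ^ N) * (1 / 2) ^ k" for k
  proof -
    have "1 * R0 \<le> 4 ^ k * R" using R assms(2) by (intro mult_mono) auto
    then have "a (4 ^ k * R) \<le> C * (4 ^ k * R) ^ N" by (intro growth) simp
    then have "?q ^ k * a (4 ^ k * R) \<le> ?q ^ k * (C * (4 ^ k * R) ^ N)"
      using q(2) by (intro mult_left_mono zero_le_power)
    also have "\<dots> = (C * R ^ N) * (1 / 2) ^ k"
      by (simp add: power_mult_distrib power_divide power_mult[symmetric] mult.commute[of N k])
    finally show ?thesis using it[OF R, of k] by linarith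
  qed
  have "(\<lambda>k. 2 * A + (C * R ^ N) * (1 / 2) ^ k) \<longlonglongrightarrow> 2 * A + (C * R ^ N) * 0"
    by (intro tendsto_intros LIMSEQ_power_zero) simp
  then show ?thesis
    using LIMSEQ_le_const[of "\<lambda>k. 2 * A + (C * R ^ N) * (1 / 2) ^ k" "2 * A" "a R"] le by auto
qed

section \<open>Local energy and the Caccioppoli inequality\<close>

context weak_solution
begin

lemma energy_identity:
  assumes \<psi>: "C1 \<psi>" "\<And>x. x \<notin> cball z R \<Longrightarrow> \<psi> x = 0"
  shows "(LINT x|lborel. \<psi> x * (\<epsilon>\<^sup>2 * ((J x *v g x) \<bullet> g x) + V x * (u x)\<^sup>2 - u x powr (p + 1))
    + \<epsilon>\<^sup>2 * (u x * ((J x *v g x) \<bullet> grad \<psi> x))) = 0"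
proof -
  note c\<psi> = C1_continuous[OF \<psi>(1)] C1_grad_continuous[OF \<psi>(1)]
  have g0: "grad \<psi> x = 0" if "x \<notin> cball z R" for x
    using grad_eq_0_outside[OF \<psi>(2) that] .
  have gr: "grad (\<lambda>x. \<psi> x * u x) = (\<lambda>x. \<psi> x *\<^sub>R g x + u x *\<^sub>R grad \<psi> x)"
    using C1_mult(2)[OF \<psi>(1) u_C1] .
  have W: "\<epsilon>\<^sup>2 * (LINT x|lborel. (J x *v g x) \<bullet> grad (\<lambda>x. \<psi> x * u x) x) + (LINT x|lborel. V x * u x * (\<psi> x * u x))
          = (LINT x|lborel. (u x powr p) * (\<psi> x * u x))"
    by (rule weak[OF C1_mult(1)[OF \<psi>(1) u_C1], of z R]) (simp add: \<psi>(2))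
  have i: "integrable lborel (\<lambda>x. (J x *v g x) \<bullet> grad (\<lambda>x. \<psi> x * u x) x)"
    "integrable lborel (\<lambda>x. V x * u x * (\<psi> x * u x))"
    "integrable lborel (\<lambda>x. (u x powr p) * (\<psi> x * u x))"
    unfolding gr by (intro integrable_compact_support[where z=z and R=R] continuous_intros c\<psi>; simp add: \<psi>(2) g0)+
  have "\<psi> x * (\<epsilon>\<^sup>2 * ((J x *v g x) \<bullet> g x) + V x * (u x)\<^sup>2 - u x powr (p + 1))
    + \<epsilon>\<^sup>2 * (u x * ((J x *v g x) \<bullet> grad \<psi> x))
    = \<epsilon>\<^sup>2 * ((J x *v g x) \<bullet> grad (\<lambda>x. \<psi> x * u x) x) + V x * u x * (\<psi> x * u x) - (u x powr p) * (\<psi> x * u x)" for x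
    unfolding gr using u_pos[of x]
    by (simp add: inner_add_right powr_add power2_eq_square algebra_simps)
  then have "(LINT x|lborel. \<psi> x * (\<epsilon>\<^sup>2 * ((J x *v g x) \<bullet> g x) + V x * (u x)\<^sup>2 - u x powr (p + 1))
    + \<epsilon>\<^sup>2 * (u x * ((J x *v g x) \<bullet> grad \<psi> x)))
    = (LINT x|lborel. \<epsilon>\<^sup>2 * ((J x *v g x) \<bullet> grad (\<lambda>x. \<psi> x * u x) x) + V x * u x * (\<psi> x * u x) - (u x powr p) * (\<psi> x * u x))"
    by presburger
  also have "\<dots> = 0"
    using i W by (simp only: Bochner_Integration.integral_add Bochner_Integration.integral_diff
       Bochner_Integration.integrable_add Bochner_Integration.integrable_diff integrable_mult_right integral_mult_right_zero)
  finally show ?thesis .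
qed

definition dens :: "real^'n \<Rightarrow> real" where
  "dens x = \<epsilon>\<^sup>2 * (norm (g x))\<^sup>2 + (u x)\<^sup>2"

lemma dens_pos: "dens x > 0"
  using u_pos[of x] by (simp add: dens_def add_nonneg_pos)

lemma cont_dens [continuous_intros]: "continuous_on UNIV dens"
  unfolding dens_def by (intro continuous_intros)

lemma u_sq_le_dens: "(u x)\<^sup>2 \<le> dens x"
  by (simp add: dens_def)

end

text \<open>The threshold \<open>\<alpha> / 2\<close> in \<open>small\<close> is half of the lower
  bound for \<open>V\<close>: at distance at least \<open>r\<close> from \<open>z\<close> it gives
  \<open>V x * (u x)\<^sup>2 - u x powr (p + 1) \<ge> \<alpha> / 2 * (u x)\<^sup>2\<close>. The
  equation is coercive there, and its nonlinearity is absorbed by the potential.\<close>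

locale concentrated_solution = weak_solution V J p \<epsilon> u
  for V :: "real^'n \<Rightarrow> real" and J :: "real^'n \<Rightarrow> real^'n^'n" and p \<epsilon> :: real and u :: "real^'n \<Rightarrow> real" +
  fixes \<Lambda> \<nu> \<alpha> r :: real and z :: "real^'n"
  assumes J_bound: "norm (J x) \<le> \<Lambda>"
    and elliptic: "\<nu> * (norm \<xi>)\<^sup>2 \<le> (J x *v \<xi>) \<bullet> \<xi>" "\<nu> > 0"
    and V_bound: "V x \<ge> \<alpha>" "\<alpha> > 0"
    and r: "r > 0"
    and small: "norm (x - z) \<ge> r \<Longrightarrow> u x powr (p - 1) \<le> \<alpha> / 2"
begin

text \<open>The quotient of the constants \<open>?c\<close> and \<open>?m\<close> that come up in
  the proof of \<open>caccioppoli\<close>.\<close>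

definition K :: real where "K = 4 * \<Lambda>\<^sup>2 / (\<nu> * min \<nu> \<alpha>)"

lemma K_nonneg: "K \<ge> 0"
  using elliptic(2) V_bound(2) by (simp add: K_def)

lemma u_powr_le: "norm (x - z) \<ge> r \<Longrightarrow> u x powr (p + 1) \<le> \<alpha> / 2 * (u x)\<^sup>2"
proof -
  assume "norm (x - z) \<ge> r"
  have "u x powr (p + 1) = u x powr (p - 1) * u x powr 2"
    by (simp add: powr_add[symmetric] algebra_simps)
  also have "u x powr 2 = (u x)\<^sup>2" using u_pos[of x] by simp
  also have "u x powr (p - 1) * (u x)\<^sup>2 \<le> \<alpha> / 2 * (u x)\<^sup>2"
    by (rule mult_right_mono[OF small[OF \<open>norm (x - z) \<ge> r\<close>]]) simp
  finally show ?thesis .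
qed

text \<open>The equation is tested with \<open>\<zeta>\<^sup>2 u\<close>. As \<zeta> vanishes on the
  ball where the nonlinearity is not controlled, the remaining terms are coercive, and the mixed
  term is absorbed at the price of the gradient of \<zeta>.\<close>

lemma caccioppoli:
  assumes \<zeta>: "C1 \<zeta>" "\<And>x. x \<notin> cball z R \<Longrightarrow> \<zeta> x = 0" "\<And>x. norm (x - z) < r \<Longrightarrow> \<zeta> x = 0"
  shows "(LINT x|lborel. (\<zeta> x)\<^sup>2 * dens x) \<le> K * \<epsilon>\<^sup>2 * (LINT x|lborel. (u x)\<^sup>2 * (norm (grad \<zeta> x))\<^sup>2)"
proof -
  note c\<zeta> = C1_continuous[OF \<zeta>(1)] C1_grad_continuous[OF \<zeta>(1)]
  have g0: "grad \<zeta> x = 0" if "x \<notin> cball z R" for x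
    using grad_eq_0_outside[OF \<zeta>(2) that] .
  let ?m = "min \<nu> \<alpha> / 2" and ?c = "2 * \<Lambda>\<^sup>2 / \<nu>"
  let ?E = "\<lambda>x. \<zeta> x * \<zeta> x * (\<epsilon>\<^sup>2 * ((J x *v g x) \<bullet> g x) + V x * (u x)\<^sup>2 - u x powr (p + 1))
    + \<epsilon>\<^sup>2 * (u x * ((J x *v g x) \<bullet> (\<zeta> x *\<^sub>R grad \<zeta> x + \<zeta> x *\<^sub>R grad \<zeta> x)))"
  have E: "(LINT x|lborel. ?E x) = 0"
    using energy_identity[OF C1_mult(1)[OF \<zeta>(1) \<zeta>(1)], of z R] \<zeta>(2)
    unfolding C1_mult(2)[OF \<zeta>(1) \<zeta>(1)] by simp
  have iE: "integrable lborel ?E"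
    by (intro integrable_compact_support[where z=z and R=R] continuous_intros c\<zeta>) (simp add: \<zeta>(2) g0)
  have i1: "integrable lborel (\<lambda>x. (\<zeta> x)\<^sup>2 * dens x)"
    by (intro integrable_compact_support[where z=z and R=R] continuous_intros c\<zeta>) (simp add: \<zeta>(2) g0)
  have i2: "integrable lborel (\<lambda>x. (u x)\<^sup>2 * (norm (grad \<zeta> x))\<^sup>2)"
    by (intro integrable_compact_support[where z=z and R=R] continuous_intros c\<zeta>) (simp add: \<zeta>(2) g0)
  have pw: "?m * ((\<zeta> x)\<^sup>2 * dens x) - ?c * \<epsilon>\<^sup>2 * ((u x)\<^sup>2 * (norm (grad \<zeta> x))\<^sup>2) \<le> ?E x" for x
  proof (cases "norm (x - z) < r")
    case True
    then show ?thesis using \<zeta>(3)[OF True] elliptic(2) by simp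
  next
    case False
    let ?G = "norm (g x)" and ?Z = "norm (grad \<zeta> x)"
    have "\<bar>(J x *v g x) \<bullet> grad \<zeta> x\<bar> \<le> norm (J x *v g x) * ?Z" by (rule Cauchy_Schwarz_ineq2)
    also have "\<dots> \<le> (\<Lambda> * ?G) * ?Z"
      by (intro mult_right_mono order_trans[OF norm_matrix_vector_le] J_bound) auto
    finally have JZ: "\<bar>(J x *v g x) \<bullet> grad \<zeta> x\<bar> \<le> \<Lambda> * ?G * ?Z" .
    have "\<bar>2 * (\<zeta> x * u x * ((J x *v g x) \<bullet> grad \<zeta> x))\<bar> \<le> 2 * (\<bar>\<zeta> x\<bar> * u x * (\<Lambda> * ?G * ?Z))"
      using JZ u_pos[of x] by (auto simp: abs_mult intro!: mult_mono)
    also have "\<dots> = 2 * (\<bar>\<zeta> x\<bar> * ?G) * (u x * \<Lambda> * ?Z)" by simp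
    \<comment> \<open>Young's inequality, weighted so that exactly half of the ellipticity is spent;
      the other half provides the gradient part of \<open>dens\<close> below.\<close>
    also have "\<dots> \<le> \<nu> / 2 * (\<bar>\<zeta> x\<bar> * ?G)\<^sup>2 + 2 / \<nu> * (u x * \<Lambda> * ?Z)\<^sup>2"
    proof -
      have "0 \<le> (\<nu> * (\<bar>\<zeta> x\<bar> * ?G) - 2 * (u x * \<Lambda> * ?Z))\<^sup>2 / (2 * \<nu>)" using elliptic(2) by simp
      then show ?thesis using elliptic(2) by (simp add: power2_eq_square field_simps)
    qed
    finally have 1: "- (\<nu> / 2 * (\<zeta> x)\<^sup>2 * ?G\<^sup>2 + ?c * (u x)\<^sup>2 * ?Z\<^sup>2) \<le> 2 * (\<zeta> x * u x * ((J x *v g x) \<bullet> grad \<zeta> x))"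
      by (simp add: power_mult_distrib abs_le_iff mult_ac)
    have 2: "\<alpha> / 2 * (u x)\<^sup>2 \<le> V x * (u x)\<^sup>2 - u x powr (p + 1)"
    proof -
      have "\<alpha> * (u x)\<^sup>2 \<le> V x * (u x)\<^sup>2" using V_bound(1) by (simp add: mult_right_mono)
      with u_powr_le[of x] False show ?thesis by simp
    qed
    have "?m * dens x \<le> \<epsilon>\<^sup>2 * (\<nu> / 2 * ?G\<^sup>2) + \<alpha> / 2 * (u x)\<^sup>2"
    proof -
      have "?m * (\<epsilon>\<^sup>2 * ?G\<^sup>2) \<le> \<nu> / 2 * (\<epsilon>\<^sup>2 * ?G\<^sup>2)" "?m * (u x)\<^sup>2 \<le> \<alpha> / 2 * (u x)\<^sup>2"
        by (intro mult_right_mono; simp)+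
      then show ?thesis by (simp add: dens_def algebra_simps)
    qed
    also have "\<dots> \<le> \<epsilon>\<^sup>2 * ((J x *v g x) \<bullet> g x) - \<epsilon>\<^sup>2 * (\<nu> / 2 * ?G\<^sup>2) + (V x * (u x)\<^sup>2 - u x powr (p + 1))"
      using 2 mult_left_mono[OF elliptic(1)[of "g x" x], of "\<epsilon>\<^sup>2"] by simp
    finally have 3: "(\<zeta> x)\<^sup>2 * (?m * dens x) \<le> (\<zeta> x)\<^sup>2 * (\<epsilon>\<^sup>2 * ((J x *v g x) \<bullet> g x) - \<epsilon>\<^sup>2 * (\<nu> / 2 * ?G\<^sup>2) + (V x * (u x)\<^sup>2 - u x powr (p + 1)))"
      by (rule mult_left_mono) simp
    have "\<epsilon>\<^sup>2 * - (\<nu> / 2 * (\<zeta> x)\<^sup>2 * ?G\<^sup>2 + ?c * (u x)\<^sup>2 * ?Z\<^sup>2) \<le> \<epsilon>\<^sup>2 * (2 * (\<zeta> x * u x * ((J x *v g x) \<bullet> grad \<zeta> x)))"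
      using 1 by (rule mult_left_mono) simp
    with 3 show ?thesis
      unfolding inner_add_right inner_scaleR_right
      by (simp add: power2_eq_square[of "\<zeta> x"] algebra_simps)
  qed
  have "?m * (LINT x|lborel. (\<zeta> x)\<^sup>2 * dens x) - ?c * \<epsilon>\<^sup>2 * (LINT x|lborel. (u x)\<^sup>2 * (norm (grad \<zeta> x))\<^sup>2)
    = (LINT x|lborel. ?m * ((\<zeta> x)\<^sup>2 * dens x) - ?c * \<epsilon>\<^sup>2 * ((u x)\<^sup>2 * (norm (grad \<zeta> x))\<^sup>2))"
    using i1 i2 by (simp only: Bochner_Integration.integral_diff integrable_mult_right integral_mult_right_zero)
  also have "\<dots> \<le> (LINT x|lborel. ?E x)"
    by (rule integral_mono[OF _ iE pw]) (intro Bochner_Integration.integrable_diff integrable_mult_right i1 i2)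
  finally have "?m * (LINT x|lborel. (\<zeta> x)\<^sup>2 * dens x) \<le> ?c * \<epsilon>\<^sup>2 * (LINT x|lborel. (u x)\<^sup>2 * (norm (grad \<zeta> x))\<^sup>2)"
    unfolding E by simp
  moreover have "?m > 0" using elliptic(2) V_bound(2) by simp
  ultimately have "(LINT x|lborel. (\<zeta> x)\<^sup>2 * dens x) \<le> ?c * \<epsilon>\<^sup>2 * (LINT x|lborel. (u x)\<^sup>2 * (norm (grad \<zeta> x))\<^sup>2) / ?m"
    by (simp only: pos_le_divide_eq mult.commute)
  also have "\<dots> = K * \<epsilon>\<^sup>2 * (LINT x|lborel. (u x)\<^sup>2 * (norm (grad \<zeta> x))\<^sup>2)"
    by (simp add: K_def)
  finally show ?thesis .
qed

text \<open>Energy and mass near \<open>z\<close>, weighted by cutoffs; the normalizing quantity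
  \<open>M\<close> will be \<open>I (4 * r)\<close>. The mass \<open>U\<close> is kept apart because
  the right-hand side of the Caccioppoli estimate contains no gradient of \<open>u\<close>, and
  because boundedness of \<open>u\<close> controls the growth of \<open>U\<close> only.\<close>

definition I :: "real \<Rightarrow> real" where "I s = (LINT x|lborel. cutoff z s x * dens x)"
definition U :: "real \<Rightarrow> real" where "U s = (LINT x|lborel. cutoff z s x * (u x)\<^sup>2)"

lemma integrable_I: "s > 0 \<Longrightarrow> integrable lborel (\<lambda>x. cutoff z s x * dens x)"
  by (intro integrable_compact_support[where z=z and R="2 * s"] continuous_intros C1_continuous[OF cutoff_C1(1)])
    (simp add: cutoff_support)

lemma integrable_U: "s > 0 \<Longrightarrow> integrable lborel (\<lambda>x. cutoff z s x * (u x)\<^sup>2)"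
  by (intro integrable_compact_support[where z=z and R="2 * s"] continuous_intros C1_continuous[OF cutoff_C1(1)])
    (simp add: cutoff_support)

lemma U_le_I: "s > 0 \<Longrightarrow> U s \<le> I s"
  unfolding U_def I_def
  by (intro integral_mono integrable_U integrable_I mult_left_mono u_sq_le_dens cutoff_nonneg)

lemma U_nonneg: "0 \<le> U s"
  unfolding U_def by (intro Bochner_Integration.integral_nonneg mult_nonneg_nonneg cutoff_nonneg) auto

lemma I_mono: "0 < s \<Longrightarrow> 2 * s \<le> t \<Longrightarrow> I s \<le> I t"
  unfolding I_def
  by (intro integral_mono integrable_I mult_right_mono cutoff_le_cutoff) (use dens_pos in \<open>auto intro: less_imp_le\<close>)

text \<open>The weight is a difference of two cutoffs: it vanishes within distance \<open>r\<close>
  of \<open>z\<close>, as \<open>caccioppoli\<close> demands, and is 1 between the radii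
  \<open>2 * r\<close> and \<open>R\<close>. The constant 512 is 2 times 256, the 2 coming from the
  square of a sum of two gradients.\<close>

lemma annulus_estimate:
  assumes "R \<ge> r"
  shows "I (R / 2) - I (2 * r) \<le> 512 * K * \<epsilon>\<^sup>2 * (U (2 * R) / R\<^sup>2 + U (2 * r) / r\<^sup>2)"
proof -
  have R: "R > 0" using assms r by simp
  let ?\<zeta> = "\<lambda>x. cutoff z R x + (- 1) * cutoff z r x"
  let ?S = "max (2 * R) (2 * r)"
  have \<zeta>: "C1 ?\<zeta>" "grad ?\<zeta> = (\<lambda>x. cutoff_grad z R x + (- 1) *\<^sub>R cutoff_grad z r x)"
    by (rule C1_add(1)[OF cutoff_C1(1) C1_cmult(1)[OF cutoff_C1(1)]])
      (simp only: C1_add(2)[OF cutoff_C1(1) C1_cmult(1)[OF cutoff_C1(1)]] C1_cmult(2)[OF cutoff_C1(1)] cutoff_C1(2))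
  have \<zeta>0: "?\<zeta> x = 0" if "x \<notin> cball z ?S" for x
  proof -
    have "x \<notin> cball z (2 * R)" "x \<notin> cball z (2 * r)" using that by auto
    then show ?thesis by (simp add: cutoff_support R r)
  qed
  have "I (R / 2) - I (2 * r) = (LINT x|lborel. cutoff z (R/2) x * dens x - cutoff z (2 * r) x * dens x)"
    unfolding I_def using integrable_I[of "R/2"] integrable_I[of "2 * r"] R r
    by (subst Bochner_Integration.integral_diff) auto
  also have "\<dots> \<le> (LINT x|lborel. (?\<zeta> x)\<^sup>2 * dens x)"
  proof (rule integral_mono)
    show "integrable lborel (\<lambda>x. cutoff z (R/2) x * dens x - cutoff z (2 * r) x * dens x)"
      using integrable_I[of "R/2"] integrable_I[of "2 * r"] R r by auto
    show "integrable lborel (\<lambda>x. (?\<zeta> x)\<^sup>2 * dens x)"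
      by (intro integrable_compact_support[where z=z and R="?S"] continuous_intros C1_continuous[OF cutoff_C1(1)])
        (subst \<zeta>0, assumption, simp)
    fix x
    have "cutoff z (R/2) x - cutoff z (2 * r) x \<le> (?\<zeta> x)\<^sup>2"
    proof (cases "norm (x - z) \<le> 2 * r")
      case True
      then have "cutoff z (2 * r) x = 1" using r by (intro cutoff_eq_1) auto
      then have "cutoff z (R/2) x - cutoff z (2 * r) x \<le> 0" using cutoff_le_1[of z "R/2" x] by simp
      then show ?thesis by (rule order_trans) simp
    next
      case F: False
      show ?thesis
      proof (cases "norm (x - z) \<le> R")
        case True
        then have "?\<zeta> x = 1" using F r R by (simp add: cutoff_eq_1 cutoff_outside(1))
        then have "(?\<zeta> x)\<^sup>2 = 1" by (simp only: power_one)
        then show ?thesis using cutoff_le_1[of z "R/2" x] cutoff_nonneg[of z "2 * r" x] by linarith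
      next
        case False
        then have "cutoff z (R/2) x = 0" using R by (intro cutoff_outside(1)) auto
        then show ?thesis using cutoff_nonneg[of z "2 * r" x] by (smt (verit) zero_le_power2)
      qed
    qed
    then have "(cutoff z (R/2) x - cutoff z (2 * r) x) * dens x \<le> (?\<zeta> x)\<^sup>2 * dens x"
      by (rule mult_right_mono) (use dens_pos[of x] in simp)
    then show "cutoff z (R/2) x * dens x - cutoff z (2 * r) x * dens x \<le> (?\<zeta> x)\<^sup>2 * dens x"
      by (simp add: left_diff_distrib)
  qed
  also have "\<dots> \<le> K * \<epsilon>\<^sup>2 * (LINT x|lborel. (u x)\<^sup>2 * (norm (grad ?\<zeta> x))\<^sup>2)"
  proof (rule caccioppoli[OF \<zeta>(1) \<zeta>0])
    fix x show "?\<zeta> x = 0" if "norm (x - z) < r" for x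
      using that R r assms by (simp add: cutoff_eq_1)
  qed
  also have "\<dots> \<le> K * \<epsilon>\<^sup>2 * (512 / R\<^sup>2 * U (2 * R) + 512 / r\<^sup>2 * U (2 * r))"
  proof (rule mult_left_mono)
    have "(LINT x|lborel. (u x)\<^sup>2 * (norm (grad ?\<zeta> x))\<^sup>2)
      \<le> (LINT x|lborel. 512 / R\<^sup>2 * (cutoff z (2 * R) x * (u x)\<^sup>2) + 512 / r\<^sup>2 * (cutoff z (2 * r) x * (u x)\<^sup>2))"
    proof (rule integral_mono)
      have gz: "grad ?\<zeta> x = 0" if "x \<notin> cball z ?S" for x
        by (rule grad_eq_0_outside[OF \<zeta>0 that])
      show "integrable lborel (\<lambda>x. (u x)\<^sup>2 * (norm (grad ?\<zeta> x))\<^sup>2)"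
        by (intro integrable_compact_support[where z=z and R="?S"] continuous_intros C1_grad_continuous[OF \<zeta>(1)])
          (subst gz, assumption, simp)
      show "integrable lborel (\<lambda>x. 512 / R\<^sup>2 * (cutoff z (2 * R) x * (u x)\<^sup>2) + 512 / r\<^sup>2 * (cutoff z (2 * r) x * (u x)\<^sup>2))"
        using R r by (intro Bochner_Integration.integrable_add integrable_mult_right integrable_U) auto
      fix x
      have "(norm (grad ?\<zeta> x))\<^sup>2 \<le> (norm (cutoff_grad z R x) + norm (cutoff_grad z r x))\<^sup>2"
        unfolding \<zeta>(2) by (intro power_mono order_trans[OF norm_triangle_ineq]) auto
      also have "\<dots> \<le> 2 * (norm (cutoff_grad z R x))\<^sup>2 + 2 * (norm (cutoff_grad z r x))\<^sup>2"
        using sum_squares_bound[of "norm (cutoff_grad z R x)" "norm (cutoff_grad z r x)"]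
        by (simp add: power2_sum)
      also have "\<dots> \<le> 2 * (256 / R\<^sup>2 * cutoff z (2 * R) x) + 2 * (256 / r\<^sup>2 * cutoff z (2 * r) x)"
        by (intro add_mono mult_left_mono norm_cutoff_grad_sq_le R r) auto
      finally have "(u x)\<^sup>2 * (norm (grad ?\<zeta> x))\<^sup>2 \<le> (u x)\<^sup>2 * (2 * (256 / R\<^sup>2 * cutoff z (2 * R) x) + 2 * (256 / r\<^sup>2 * cutoff z (2 * r) x))"
        by (rule mult_left_mono) simp
      then show "(u x)\<^sup>2 * (norm (grad ?\<zeta> x))\<^sup>2
        \<le> 512 / R\<^sup>2 * (cutoff z (2 * R) x * (u x)\<^sup>2) + 512 / r\<^sup>2 * (cutoff z (2 * r) x * (u x)\<^sup>2)"
        by (simp add: algebra_simps)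
    qed
    also have "\<dots> = 512 / R\<^sup>2 * U (2 * R) + 512 / r\<^sup>2 * U (2 * r)"
      unfolding U_def using integrable_U[of "2 * R"] integrable_U[of "2 * r"] R r
      by (subst Bochner_Integration.integral_add) auto
    finally show "(LINT x|lborel. (u x)\<^sup>2 * (norm (grad ?\<zeta> x))\<^sup>2) \<le> 512 / R\<^sup>2 * U (2 * R) + 512 / r\<^sup>2 * U (2 * r)" .
    show "0 \<le> K * \<epsilon>\<^sup>2" using K_nonneg by simp
  qed
  finally show ?thesis by (simp add: algebra_simps)
qed

lemma u_bounded: "\<exists>B. \<forall>x. u x \<le> B"
proof -
  have "(u \<longlongrightarrow> 0) at_infinity" using sol by (simp add: is_solution_def)
  then have "\<forall>\<^sub>F x in at_infinity. u x < 1" by (rule order_tendstoD) simp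
  then obtain b where b: "\<And>x. norm x \<ge> b \<Longrightarrow> u x < 1"
    unfolding eventually_at_infinity by blast
  have "bounded (u ` cball 0 b)"
    by (intro compact_imp_bounded compact_continuous_image continuous_on_subset[OF cont(1)] compact_cball) auto
  then obtain B where B: "\<And>x. x \<in> cball 0 b \<Longrightarrow> \<bar>u x\<bar> \<le> B"
    unfolding bounded_iff real_norm_def by (metis imageI)
  have "u x \<le> max B 1" for x
  proof (cases "norm x \<ge> b")
    case True then show ?thesis using b[OF True] by simp
  next
    case False then show ?thesis using B[of x] by simp
  qed
  then show ?thesis by blast
qed

lemma U_growth: "\<exists>C. \<forall>R>0. U R \<le> C * R ^ CARD('n)"
proof -
  obtain B where B: "\<And>x. u x \<le> B" using u_bounded by blast
  let ?\<omega> = "measure lborel (ball (0::real^'n) 1)"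
  have "U R \<le> B\<^sup>2 * (2 ^ CARD('n) * ?\<omega>) * R ^ CARD('n)" if R: "R > 0" for R
  proof -
    have "U R \<le> (LINT x|lborel. B\<^sup>2 * indicator (cball z (2 * R)) x)"
      unfolding U_def
    proof (rule integral_mono[OF integrable_U[OF R]])
      show "integrable lborel (\<lambda>x. B\<^sup>2 * indicator (cball z (2 * R)) x)"
        by (intro integrable_mult_right integrable_real_indicator) (use emeasure_lborel_cball_finite[of z "2 * R"] in auto)
      fix x
      have "(u x)\<^sup>2 \<le> B\<^sup>2" using B[of x] u_pos[of x] by (intro power_mono) auto
      then have "cutoff z R x * (u x)\<^sup>2 \<le> 1 * B\<^sup>2"
        by (intro mult_mono cutoff_le_1) auto
      then show "cutoff z R x * (u x)\<^sup>2 \<le> B\<^sup>2 * indicator (cball z (2 * R)) x"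
        using cutoff_support[OF R, of x z] by (auto simp: indicator_def)
    qed
    also have "\<dots> = B\<^sup>2 * measure lborel (cball z (2 * R))" by simp
    also have "measure lborel (cball z (2 * R)) = (2 * R) ^ CARD('n) * ?\<omega>"
      using R content_ball_conv_unit_ball[of "2 * R" z] by (simp add: content_cball_conv_ball)
    finally show ?thesis by (simp add: power_mult_distrib mult_ac)
  qed
  then show ?thesis by blast
qed

text \<open>Here the mass over the whole space is seen to be finite: the annulus estimate at radius
  \<open>2 * R\<close>, combined with \<open>U R \<le> I R\<close>, is a growth iteration whose
  factor decays like \<open>1 / R\<^sup>2\<close>.\<close>

lemma U_bounded: "\<exists>A R0. R0 > 0 \<and> (\<forall>R\<ge>R0. U R \<le> A)"
proof -
  obtain C where C: "\<And>R. R > 0 \<Longrightarrow> U R \<le> C * R ^ CARD('n)" using U_growth by blast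
  let ?D = "512 * K * \<epsilon>\<^sup>2" and ?N = "CARD('n)"
  let ?A = "I (2 * r) + ?D * (U (2 * r) / r\<^sup>2)"
  \<comment> \<open>Beyond this radius the factor \<open>?D / (2 * R)\<^sup>2\<close> is at most
    \<open>1 / (2 * 4 ^ ?N)\<close>, the contraction that the iteration requires; the summand 1
    gives \<open>R \<le> R * R\<close>.\<close>
  define R0 where "R0 = r + 1 + ?D * 2 * 4 ^ ?N"
  have D: "?D \<ge> 0" using K_nonneg by simp
  have I0: "I (2 * r) \<ge> 0" using U_nonneg[of "2 * r"] U_le_I[of "2 * r"] r by simp
  have A: "?A \<ge> 0" using I0 D U_nonneg[of "2 * r"] by simp
  have R0: "R0 \<ge> r" "R0 \<ge> 1" "R0 \<ge> ?D * 2 * 4 ^ ?N"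
    unfolding R0_def using D r by auto
  have "U R \<le> ?A + 1 / (2 * 4 ^ ?N) * U (4 * R)" if R: "R \<ge> R0" for R
  proof -
    have R1: "R \<ge> 1" "R \<ge> r" using R R0 by linarith+
    have "I (2 * R / 2) - I (2 * r) \<le> ?D * (U (2 * (2 * R)) / (2 * R)\<^sup>2 + U (2 * r) / r\<^sup>2)"
      by (rule annulus_estimate) (use R1 in auto)
    then have "I R \<le> ?A + ?D * (U (4 * R) / (2 * R)\<^sup>2)" by (simp add: distrib_left)
    moreover have "?D * (U (4 * R) / (2 * R)\<^sup>2) \<le> 1 / (2 * 4 ^ ?N) * U (4 * R)"
    proof -
      have "?D * 2 * 4 ^ ?N \<le> R * 1" using R R0 by linarith
      also have "\<dots> \<le> R * R" using R1 by (intro mult_left_mono) auto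
      also have "\<dots> \<le> (2 * R)\<^sup>2" by (simp add: power2_eq_square)
      finally have "?D / (2 * R)\<^sup>2 \<le> 1 / (2 * 4 ^ ?N)"
        using R1 by (simp add: field_simps)
      from mult_right_mono[OF this U_nonneg, of "4 * R"] show ?thesis by (simp add: mult.assoc)
    qed
    ultimately show ?thesis using U_le_I[of R] R1 by linarith
  qed
  then have "U R \<le> 2 * ?A" if "R \<ge> R0" for R
    using bounded_of_growth_iteration[OF A, of R0 U ?N C R] C R0 that by simp
  moreover have "R0 > 0" using R0 by linarith
  ultimately show ?thesis by blast
qed

text \<open>As the outer radius tends to infinity the outer boundary term vanishes, the mass being
  bounded. What is left compares the energy outside with the energy inside, with a factor that tends
  to 0 with \<epsilon>; the bound is relative, so no size of the energy has to be known.\<close>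

lemma tail_estimate:
  assumes "s > 0"
  shows "I s - I (2 * r) \<le> 512 * K * \<epsilon>\<^sup>2 / r\<^sup>2 * I (2 * r)"
proof -
  obtain A R0 where A: "R0 > 0" "\<And>R. R \<ge> R0 \<Longrightarrow> U R \<le> A" using U_bounded by blast
  let ?D = "512 * K * \<epsilon>\<^sup>2"
  have D: "?D \<ge> 0" using K_nonneg by simp
  have bd: "I s - I (2 * r) \<le> ?D * (A * (inverse R)\<^sup>2 + I (2 * r) / r\<^sup>2)" if R: "R \<ge> R0 + r + 4 * s" for R
  proof -
    have "I s \<le> I (R / 2)" by (rule I_mono) (use assms R A(1) r in auto)
    moreover have "I (R / 2) - I (2 * r) \<le> ?D * (U (2 * R) / R\<^sup>2 + U (2 * r) / r\<^sup>2)"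
      by (rule annulus_estimate) (use assms R A(1) in auto)
    moreover have "?D * (U (2 * R) / R\<^sup>2 + U (2 * r) / r\<^sup>2) \<le> ?D * (A / R\<^sup>2 + I (2 * r) / r\<^sup>2)"
    proof -
      have "U (2 * R) \<le> A" using A R assms r by (intro A(2)) linarith
      then show ?thesis using U_le_I[of "2 * r"] r D
        by (intro mult_left_mono add_mono divide_right_mono) auto
    qed
    moreover have "A / R\<^sup>2 = A * (inverse R)\<^sup>2" unfolding power_inverse by (rule divide_inverse)
    ultimately show ?thesis by (simp only:)
  qed
  have "((\<lambda>R. ?D * (A * (inverse R)\<^sup>2 + I (2 * r) / r\<^sup>2)) \<longlongrightarrow> ?D * (A * 0\<^sup>2 + I (2 * r) / r\<^sup>2)) at_top"
    by (intro tendsto_intros tendsto_inverse_0_at_top filterlim_ident)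
  then have "I s - I (2 * r) \<le> ?D * (A * 0\<^sup>2 + I (2 * r) / r\<^sup>2)"
    by (rule tendsto_lowerbound) (use bd in \<open>auto intro: eventually_at_top_linorderI\<close>)
  then show ?thesis by simp
qed

end

section \<open>Matrix pairings and the stress tensor with frozen coefficients\<close>

definition dyad :: "real^'n \<Rightarrow> real^'n \<Rightarrow> real^'n^'n" where
  "dyad v w = (\<chi> i j. v $ i * w $ j)"

lemma dyad_inner: "dyad v w \<bullet> A = v \<bullet> (A *v w)"
  by (simp add: dyad_def inner_vec_def matrix_vector_mult_def sum_distrib_left mult_ac)

lemma outer_mult_vec: "outer g *v w = (g \<bullet> w) *\<^sub>R g"
  by (simp add: outer_def vec_eq_iff matrix_vector_mult_def inner_vec_def sum_distrib_left sum_distrib_right mult_ac)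

lemma norm_sq_eq_inner_outer: "(norm g)\<^sup>2 = mat 1 \<bullet> outer g"
  by (simp add: inner_outer power2_norm_eq_inner)

lemma abs_inner_matrix_le:
  assumes "norm A \<le> L"
  shows "\<bar>(A *v v) \<bullet> w\<bar> \<le> L * norm (v :: real^'n) * norm w"
proof -
  have "\<bar>(A *v v) \<bullet> w\<bar> \<le> norm (A *v v) * norm w" by (rule Cauchy_Schwarz_ineq2)
  also have "\<dots> \<le> (L * norm v) * norm w"
    by (intro mult_right_mono order_trans[OF norm_matrix_vector_le] assms) auto
  finally show ?thesis .
qed

lemma abs_inner_outer_le:
  assumes "norm A \<le> L"
  shows "\<bar>A \<bullet> outer v\<bar> \<le> L * (norm v)\<^sup>2"
  using abs_inner_matrix_le[OF assms, of v v] by (simp add: inner_outer power2_eq_square mult_ac)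

context weak_solution
begin

text \<open>The energy-momentum tensor of the equation with constant coefficients \<open>A\<close>
  and \<open>c\<close>, contracted with the direction \<open>b\<close> of the vector field and the
  gradient \<open>w\<close> of its weight. By \<open>poho_eq_stress\<close> it is the part of
  \<open>poho\<close> that contains the gradient of the weight.\<close>

definition stress :: "real^'n^'n \<Rightarrow> real \<Rightarrow> real^'n \<Rightarrow> real^'n \<Rightarrow> real^'n \<Rightarrow> real" where
  "stress A c b w x = \<epsilon>\<^sup>2 * (((A *v g x) \<bullet> w) * (b \<bullet> g x) - (b \<bullet> w) * ((A *v g x) \<bullet> g x) / 2)
    - (u x)\<^sup>2 * c * (b \<bullet> w) / 2 + u x powr (p + 1) / (p + 1) * (b \<bullet> w)"

lemma poho_eq_stress:
  "poho b \<psi> x = stress (J x) (V x) b (grad \<psi> x) x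
     - \<psi> x * (\<epsilon>\<^sup>2 * (DJ x b \<bullet> outer (g x)) + (u x)\<^sup>2 * (b \<bullet> grad V x)) / 2"
  by (simp add: poho_def stress_def algebra_simps add_divide_distrib diff_divide_distrib)

lemma stress_linear: "stress A c b (k *\<^sub>R v + l *\<^sub>R w) x = k * stress A c b v x + l * stress A c b w x"
  by (simp add: stress_def inner_add_right algebra_simps add_divide_distrib diff_divide_distrib)

lemma cont_stress [continuous_intros]: "continuous_on UNIV (\<lambda>x. stress A c b w x)"
  unfolding stress_def using p by (auto intro!: continuous_intros)

text \<open>The power term depends on neither \<open>A\<close> nor \<open>c\<close> and cancels in
  the difference. This is why freezing coefficients costs only a multiple of \<open>dens\<close>,
  also near \<open>z\<close> where the power of \<open>u\<close> is not bounded by it.\<close>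

lemma stress_diff_le:
  assumes A: "norm (A - A') \<le> \<omega>" and c: "\<bar>c - c'\<bar> \<le> \<omega>" and b: "norm b \<le> 1" and w: "norm w \<le> 1"
  shows "\<bar>stress A c b w x - stress A' c' b w x\<bar> \<le> 2 * \<omega> * dens x"
proof -
  let ?G = "norm (g x)"
  have \<omega>: "\<omega> \<ge> 0" using c by linarith
  have bw: "\<bar>b \<bullet> w\<bar> \<le> 1"
    using Cauchy_Schwarz_ineq2[of b w] mult_le_one[OF b _ w] by (meson norm_ge_zero order_trans)
  have bg: "\<bar>b \<bullet> g x\<bar> \<le> ?G"
    using Cauchy_Schwarz_ineq2[of b "g x"] mult_right_mono[OF b, of ?G] by simp
  have 1: "\<bar>((A - A') *v g x) \<bullet> w\<bar> \<le> \<omega> * ?G"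
    using abs_inner_matrix_le[OF A, of "g x" w] mult_left_mono[OF w, of "\<omega> * ?G"] \<omega> by simp
  have 2: "\<bar>((A - A') *v g x) \<bullet> g x\<bar> \<le> \<omega> * ?G\<^sup>2"
    using abs_inner_matrix_le[OF A, of "g x" "g x"] by (simp add: power2_eq_square mult_ac)
  have "\<bar>(((A - A') *v g x) \<bullet> w) * (b \<bullet> g x)\<bar> \<le> (\<omega> * ?G) * ?G"
    unfolding abs_mult by (intro mult_mono 1 bg) (use \<omega> in auto)
  moreover have "\<bar>(b \<bullet> w) * (((A - A') *v g x) \<bullet> g x)\<bar> \<le> 1 * (\<omega> * ?G\<^sup>2)"
    unfolding abs_mult by (intro mult_mono 2 bw) auto
  ultimately have "\<bar>(((A - A') *v g x) \<bullet> w) * (b \<bullet> g x) - (b \<bullet> w) * (((A - A') *v g x) \<bullet> g x) / 2\<bar> \<le> 2 * \<omega> * ?G\<^sup>2"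
    unfolding power2_eq_square by linarith
  then have 3: "\<epsilon>\<^sup>2 * \<bar>(((A - A') *v g x) \<bullet> w) * (b \<bullet> g x) - (b \<bullet> w) * (((A - A') *v g x) \<bullet> g x) / 2\<bar> \<le> \<epsilon>\<^sup>2 * (2 * \<omega> * ?G\<^sup>2)"
    by (rule mult_left_mono) simp
  have "\<bar>(c - c') * (b \<bullet> w)\<bar> \<le> \<omega> * 1"
    unfolding abs_mult by (intro mult_mono c bw) (use \<omega> in auto)
  then have 4: "(u x)\<^sup>2 * \<bar>(c - c') * (b \<bullet> w)\<bar> \<le> (u x)\<^sup>2 * \<omega>"
    by (intro mult_left_mono) auto
  have "stress A c b w x - stress A' c' b w x
    = \<epsilon>\<^sup>2 * ((((A - A') *v g x) \<bullet> w) * (b \<bullet> g x) - (b \<bullet> w) * (((A - A') *v g x) \<bullet> g x) / 2)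
      - (u x)\<^sup>2 * ((c - c') * (b \<bullet> w)) / 2"
    by (simp add: stress_def matrix_vector_mult_diff_rdistrib inner_diff_left algebra_simps add_divide_distrib diff_divide_distrib)
  also have "\<bar>\<dots>\<bar> \<le> \<epsilon>\<^sup>2 * (2 * \<omega> * ?G\<^sup>2) + (u x)\<^sup>2 * \<omega> / 2"
  proof -
    have "\<bar>X - Y / 2\<bar> \<le> C + D / 2" if "\<bar>X\<bar> \<le> C" "\<bar>Y\<bar> \<le> D" for X Y C D :: real using that by linarith
    moreover have "\<bar>\<epsilon>\<^sup>2 * ((((A - A') *v g x) \<bullet> w) * (b \<bullet> g x) - (b \<bullet> w) * (((A - A') *v g x) \<bullet> g x) / 2)\<bar> \<le> \<epsilon>\<^sup>2 * (2 * \<omega> * ?G\<^sup>2)"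
      using 3 unfolding abs_mult[of "\<epsilon>\<^sup>2"] by simp
    moreover have "\<bar>(u x)\<^sup>2 * ((c - c') * (b \<bullet> w))\<bar> \<le> (u x)\<^sup>2 * \<omega>"
      using 4 unfolding abs_mult[of "(u x)\<^sup>2"] by simp
    ultimately show ?thesis by blast
  qed
  also have "\<dots> \<le> 2 * \<omega> * dens x"
  proof -
    have "(u x)\<^sup>2 * \<omega> \<ge> 0" using \<omega> by simp
    then show ?thesis by (simp add: dens_def algebra_simps)
  qed
  finally show ?thesis .
qed

end

text \<open>The radius \<open>8 * r\<close> is that of a ball containing the support of the cutoff
  with parameter \<open>4 * r\<close>. On it a linear function \<open>a \<bullet> (x - z)\<close>
  with unit \<open>a\<close> is at most \<open>8 * r\<close>, whence the last two conditions: they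
  make the derivatives of the coefficients negligible when tested with linear fields.\<close>

locale local_solution = concentrated_solution V J p \<epsilon> u \<Lambda> \<nu> \<alpha> r z
  for V :: "real^'n \<Rightarrow> real" and J :: "real^'n \<Rightarrow> real^'n^'n" and p \<epsilon> :: real and u :: "real^'n \<Rightarrow> real"
    and \<Lambda> \<nu> \<alpha> r :: real and z :: "real^'n" +
  fixes \<omega> W :: real
  assumes eps_le: "\<epsilon> \<le> 1"
    and near: "norm (x - z) \<le> 8 * r \<Longrightarrow> norm (J x - J z) \<le> \<omega>"
      "norm (x - z) \<le> 8 * r \<Longrightarrow> \<bar>V x - V z\<bar> \<le> \<omega>"
      "norm (x - z) \<le> 8 * r \<Longrightarrow> \<bar>V x\<bar> \<le> W"
    and near_deriv: "norm (x - z) \<le> 8 * r \<Longrightarrow> b \<in> Basis \<Longrightarrow> norm (DJ x b - DJ z b) \<le> \<omega>"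
      "norm (x - z) \<le> 8 * r \<Longrightarrow> b \<in> Basis \<Longrightarrow> \<bar>b \<bullet> grad V x - b \<bullet> grad V z\<bar> \<le> \<omega>"
      "norm (x - z) \<le> 8 * r \<Longrightarrow> b \<in> Basis \<Longrightarrow> 8 * r * norm (DJ x b) \<le> \<omega>"
      "norm (x - z) \<le> 8 * r \<Longrightarrow> b \<in> Basis \<Longrightarrow> 8 * r * \<bar>b \<bullet> grad V x\<bar> \<le> \<omega>"
begin

section \<open>Boundary terms, where the cutoff varies\<close>

abbreviation "ch \<equiv> cutoff z (4 * r)"

abbreviation "dch \<equiv> cutoff_grad z (4 * r)"

text \<open>The cutoff gradient is at most \<open>16 / (4 * r)\<close>, that is
  \<open>4 / r\<close>, and the weights in use are at most \<open>1 + 8 * r\<close>; their product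
  is the first factor. The second one is the constant of \<open>stress_le\<close>.\<close>

definition Cst :: real where "Cst = (4 / r + 32) * (2 * \<Lambda> + W + \<alpha>)"

definition err :: real where "err = Cst * (512 * K * \<epsilon>\<^sup>2 / r\<^sup>2)"

lemma consts_nonneg: "\<omega> \<ge> 0" "W \<ge> 0" "\<Lambda> \<ge> 0" "Cst \<ge> 0"
proof -
  show "\<omega> \<ge> 0" using near(2)[of z] r by simp
  show W: "W \<ge> 0" using near(3)[of z] r by simp
  show L: "\<Lambda> \<ge> 0" using J_bound[of z] norm_ge_zero order_trans by blast
  show "Cst \<ge> 0" unfolding Cst_def using W L r V_bound(2) by simp
qed

lemma ch_props: "C1 ch" "grad ch = dch" "0 \<le> ch x" "ch x \<le> 1" "x \<notin> cball z (8 * r) \<Longrightarrow> ch x = 0"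
  using cutoff_C1[of z "4 * r"] cutoff_nonneg[of z "4 * r" x] cutoff_le_1[of z "4 * r" x]
    cutoff_support[of "4 * r" x z] r by auto

lemma cont_ch [continuous_intros]: "continuous_on UNIV ch"
  by (rule C1_continuous[OF ch_props(1)])

lemma ch_cases:
  obtains "ch x = 0" "dch x = 0" | "norm (x - z) \<le> 8 * r"
proof (cases "norm (x - z) \<le> 8 * r")
  case False
  then show ?thesis using cutoff_outside[of "4 * r" x z] r that(1) by simp
qed (use that in blast)

lemma annulus_cutoff_nonneg: "0 \<le> (cutoff z (8 * r) x - cutoff z (2 * r) x) * dens x"
proof -
  have "cutoff z (2 * r) x \<le> cutoff z (8 * r) x" using r by (intro cutoff_le_cutoff) auto
  then show ?thesis using dens_pos[of x] by simp
qed

text \<open>The gradient of \<open>ch\<close> lives between the radii \<open>4 * r\<close> and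
  \<open>8 * r\<close>, where the difference of the two other cutoffs equals 1. Boundary terms are
  thereby dominated by \<open>I (8 * r) - I (2 * r)\<close>, to which \<open>tail_estimate\<close>
  applies.\<close>

lemma annulus_cases:
  obtains "dch x = 0"
  | "4 * r \<le> norm (x - z)" "norm (x - z) \<le> 8 * r" "cutoff z (8 * r) x - cutoff z (2 * r) x = 1" "norm (dch x) \<le> 4 / r"
proof (cases "4 * r \<le> norm (x - z) \<and> norm (x - z) \<le> 8 * r")
  case True
  then have "cutoff z (8 * r) x = 1" "cutoff z (2 * r) x = 0"
    using r by (auto intro: cutoff_eq_1 cutoff_outside(1))
  moreover have "norm (dch x) \<le> 4 / r" using norm_cutoff_grad_le[of "4 * r" z x] r by simp
  ultimately show ?thesis using that(2) True by simp
next
  case False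
  then show ?thesis using that(1) r cutoff_grad_eq_0[of "4 * r" x z] cutoff_outside(2)[of "4 * r" x z] by auto
qed

text \<open>At distance at least \<open>r\<close> the power term is dominated by the mass, so here
  the full stress, and not only a difference, is bounded by \<open>dens\<close>.\<close>

lemma stress_le:
  assumes b: "b \<in> Basis" and x: "r \<le> norm (x - z)" "norm (x - z) \<le> 8 * r"
  shows "\<bar>stress (J x) (V x) b w x\<bar> \<le> norm w * ((2 * \<Lambda> + W + \<alpha>) * dens x)"
proof -
  let ?G = "norm (g x)" and ?n = "norm w"
  note c = consts_nonneg
  have bw: "\<bar>b \<bullet> w\<bar> \<le> ?n" and bg: "\<bar>b \<bullet> g x\<bar> \<le> ?G"
    using Cauchy_Schwarz_ineq2[of b w] Cauchy_Schwarz_ineq2[of b "g x"] b by auto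
  have 1: "\<bar>((J x *v g x) \<bullet> w) * (b \<bullet> g x)\<bar> \<le> (\<Lambda> * ?G * ?n) * ?G"
    unfolding abs_mult by (intro mult_mono abs_inner_matrix_le J_bound bg) (use c in auto)
  have 2: "\<bar>(b \<bullet> w) * ((J x *v g x) \<bullet> g x)\<bar> \<le> ?n * (\<Lambda> * ?G * ?G)"
    unfolding abs_mult by (intro mult_mono abs_inner_matrix_le J_bound bw) (use c in auto)
  have "\<bar>((J x *v g x) \<bullet> w) * (b \<bullet> g x) - (b \<bullet> w) * ((J x *v g x) \<bullet> g x) / 2\<bar> \<le> 2 * (?n * (\<Lambda> * ?G * ?G))"
  proof -
    have "0 \<le> ?n * (\<Lambda> * ?G * ?G)" using c by simp
    moreover have "(\<Lambda> * ?G * ?n) * ?G = ?n * (\<Lambda> * ?G * ?G)" by simp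
    ultimately show ?thesis using 1 2 by linarith
  qed
  then have "\<epsilon>\<^sup>2 * \<bar>((J x *v g x) \<bullet> w) * (b \<bullet> g x) - (b \<bullet> w) * ((J x *v g x) \<bullet> g x) / 2\<bar> \<le> \<epsilon>\<^sup>2 * (2 * (?n * (\<Lambda> * ?G * ?G)))"
    by (rule mult_left_mono) simp
  then have A: "\<bar>\<epsilon>\<^sup>2 * (((J x *v g x) \<bullet> w) * (b \<bullet> g x) - (b \<bullet> w) * ((J x *v g x) \<bullet> g x) / 2)\<bar> \<le> ?n * (2 * \<Lambda> * (\<epsilon>\<^sup>2 * ?G\<^sup>2))"
    unfolding abs_mult[of "\<epsilon>\<^sup>2"] by (simp add: power2_eq_square mult_ac)
  have B: "\<bar>(u x)\<^sup>2 * V x * (b \<bullet> w) / 2\<bar> \<le> ?n * (W * (u x)\<^sup>2)"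
  proof -
    have "\<bar>V x\<bar> * \<bar>b \<bullet> w\<bar> \<le> W * ?n" by (intro mult_mono near(3) x bw) (use c in auto)
    then have "(u x)\<^sup>2 * (\<bar>V x\<bar> * \<bar>b \<bullet> w\<bar>) \<le> (u x)\<^sup>2 * (W * ?n)" by (rule mult_left_mono) simp
    moreover have "0 \<le> (u x)\<^sup>2 * (\<bar>V x\<bar> * \<bar>b \<bullet> w\<bar>)" by simp
    moreover have "\<bar>(u x)\<^sup>2 * V x * (b \<bullet> w) / 2\<bar> = (u x)\<^sup>2 * (\<bar>V x\<bar> * \<bar>b \<bullet> w\<bar>) / 2"
      by (simp add: abs_mult)
    ultimately have "\<bar>(u x)\<^sup>2 * V x * (b \<bullet> w) / 2\<bar> \<le> (u x)\<^sup>2 * (W * ?n)" by linarith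
    then show ?thesis by (simp only: mult_ac)
  qed
  have C: "\<bar>u x powr (p + 1) / (p + 1) * (b \<bullet> w)\<bar> \<le> ?n * (\<alpha> * (u x)\<^sup>2)"
  proof -
    have "u x powr (p + 1) / (p + 1) \<le> u x powr (p + 1) / 1"
      using p by (intro divide_left_mono) auto
    also have "\<dots> \<le> \<alpha> * (u x)\<^sup>2"
    proof -
      have "u x powr (p + 1) \<le> \<alpha> / 2 * (u x)\<^sup>2" by (rule u_powr_le[OF x(1)])
      also have "\<dots> \<le> \<alpha> * (u x)\<^sup>2" using V_bound(2) by (intro mult_right_mono) auto
      finally show ?thesis by simp
    qed
    finally have "u x powr (p + 1) / (p + 1) * \<bar>b \<bullet> w\<bar> \<le> (\<alpha> * (u x)\<^sup>2) * ?n"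
      using bw V_bound(2) by (intro mult_mono) auto
    then show ?thesis using p by (simp add: abs_mult mult_ac)
  qed
  have "\<bar>stress (J x) (V x) b w x\<bar> \<le> ?n * (2 * \<Lambda> * (\<epsilon>\<^sup>2 * ?G\<^sup>2)) + ?n * (W * (u x)\<^sup>2) + ?n * (\<alpha> * (u x)\<^sup>2)"
    unfolding stress_def using A B C by linarith
  also have "\<dots> = ?n * (2 * \<Lambda> * (\<epsilon>\<^sup>2 * ?G\<^sup>2) + W * (u x)\<^sup>2 + \<alpha> * (u x)\<^sup>2)"
    by (simp add: distrib_left)
  also have "\<dots> \<le> ?n * ((2 * \<Lambda> + W + \<alpha>) * dens x)"
  proof (rule mult_left_mono)
    have "0 \<le> (W + \<alpha>) * (\<epsilon>\<^sup>2 * ?G\<^sup>2)" "0 \<le> 2 * \<Lambda> * (u x)\<^sup>2" using c V_bound(2) by auto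
    then show "2 * \<Lambda> * (\<epsilon>\<^sup>2 * ?G\<^sup>2) + W * (u x)\<^sup>2 + \<alpha> * (u x)\<^sup>2 \<le> (2 * \<Lambda> + W + \<alpha>) * dens x"
      by (simp add: dens_def algebra_simps)
  qed simp
  finally show ?thesis .
qed

lemma stress_dch_le:
  assumes b: "b \<in> Basis" and l: "norm (x - z) \<le> 8 * r \<Longrightarrow> \<bar>l\<bar> \<le> 1 + 8 * r"
  shows "\<bar>l * stress (J x) (V x) b (dch x) x\<bar> \<le> Cst * ((cutoff z (8 * r) x - cutoff z (2 * r) x) * dens x)"
proof (cases x rule: annulus_cases)
  case 1
  then show ?thesis using mult_nonneg_nonneg[OF consts_nonneg(4) annulus_cutoff_nonneg] by (simp add: stress_def)
next
  case 2
  let ?S = "(2 * \<Lambda> + W + \<alpha>) * dens x"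
  have S: "?S \<ge> 0" using consts_nonneg V_bound(2) dens_pos[of x] by simp
  have "\<bar>stress (J x) (V x) b (dch x) x\<bar> \<le> norm (dch x) * ?S"
    by (rule stress_le[OF b]) (use 2 r in auto)
  also have "\<dots> \<le> 4 / r * ?S" by (rule mult_right_mono[OF 2(4) S])
  finally have "\<bar>l\<bar> * \<bar>stress (J x) (V x) b (dch x) x\<bar> \<le> (1 + 8 * r) * (4 / r * ?S)"
    by (intro mult_mono l 2(2)) (use r in auto)
  also have "\<dots> = Cst * dens x" using r by (simp add: Cst_def field_simps)
  finally show ?thesis unfolding 2(3) by (simp add: abs_mult)
qed

lemma energy_dch_le:
  "\<bar>\<epsilon>\<^sup>2 * (u x * ((J x *v g x) \<bullet> dch x))\<bar> \<le> Cst * ((cutoff z (8 * r) x - cutoff z (2 * r) x) * dens x)"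
proof (cases x rule: annulus_cases)
  case 1
  then show ?thesis using mult_nonneg_nonneg[OF consts_nonneg(4) annulus_cutoff_nonneg] by simp
next
  case 2
  let ?G = "norm (g x)"
  note c = consts_nonneg
  have "\<bar>(J x *v g x) \<bullet> dch x\<bar> \<le> \<Lambda> * ?G * norm (dch x)"
    by (rule abs_inner_matrix_le[OF J_bound])
  also have "\<dots> \<le> \<Lambda> * ?G * (4 / r)" using c by (intro mult_left_mono 2(4)) auto
  finally have "\<epsilon>\<^sup>2 * (u x * \<bar>(J x *v g x) \<bullet> dch x\<bar>) \<le> \<epsilon>\<^sup>2 * (u x * (\<Lambda> * ?G * (4 / r)))"
    using u_pos[of x] by (intro mult_left_mono) auto
  \<comment> \<open>One factor \<epsilon> goes with the gradient to match \<open>dens\<close>; the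
    other is bounded by 1 through \<open>eps_le\<close>.\<close>
  also have "\<dots> = (4 / r * \<Lambda>) * (\<epsilon> * (u x * (\<epsilon> * ?G)))"
    by (simp add: power2_eq_square mult_ac)
  also have "\<dots> \<le> (4 / r * \<Lambda>) * dens x"
  proof (rule mult_left_mono)
    have "\<epsilon> * (u x * (\<epsilon> * ?G)) \<le> 1 * (u x * (\<epsilon> * ?G))"
      using eps_le eps u_pos[of x] by (intro mult_right_mono) auto
    also have "\<dots> \<le> dens x"
    proof -
      have "0 \<le> u x * (\<epsilon> * ?G)" using u_pos[of x] eps by simp
      then show ?thesis using sum_squares_bound[of "u x" "\<epsilon> * ?G"]
        unfolding dens_def power_mult_distrib by linarith
    qed
    finally show "\<epsilon> * (u x * (\<epsilon> * ?G)) \<le> dens x" .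
    show "0 \<le> 4 / r * \<Lambda>" using c r by simp
  qed
  also have "\<dots> \<le> Cst * dens x"
  proof (rule mult_right_mono)
    show "4 / r * \<Lambda> \<le> Cst"
      unfolding Cst_def using c r V_bound(2) by (intro mult_mono) auto
    show "0 \<le> dens x" using dens_pos[of x] by simp
  qed
  finally show ?thesis unfolding 2(3) using u_pos[of x] by (simp add: abs_mult)
qed

text \<open>The common pattern of the next three estimates: \<open>F\<close> is an exact identity
  with variable coefficients, \<open>G\<close> its main part with coefficients frozen at
  \<open>z\<close>. The error consists of the oscillation of the coefficients, weighted by
  \<open>ch\<close>, and of boundary terms absorbed by the tail estimate.\<close>

lemma integral_main_le:
  assumes F: "integrable lborel F" "(LINT x|lborel. F x) = 0" and G: "integrable lborel G"
    and diff: "\<And>x. \<bar>F x - G x\<bar> \<le> k * \<omega> * (ch x * dens x)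
       + Cst * ((cutoff z (8 * r) x - cutoff z (2 * r) x) * dens x)"
  shows "\<bar>LINT x|lborel. G x\<bar> \<le> (k * \<omega> + err) * I (4 * r)"
proof -
  have i: "integrable lborel (\<lambda>x. k * \<omega> * (ch x * dens x)
       + Cst * (cutoff z (8 * r) x * dens x - cutoff z (2 * r) x * dens x))"
    using r by (intro Bochner_Integration.integrable_add Bochner_Integration.integrable_diff integrable_mult_right integrable_I) auto
  have "\<bar>LINT x|lborel. G x\<bar> = \<bar>LINT x|lborel. F x - G x\<bar>"
    using F G by simp
  also have "\<dots> \<le> (LINT x|lborel. \<bar>F x - G x\<bar>)"
    by (rule integral_abs_bound)
  also have "\<dots> \<le> (LINT x|lborel. k * \<omega> * (ch x * dens x)
       + Cst * (cutoff z (8 * r) x * dens x - cutoff z (2 * r) x * dens x))"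
    by (rule integral_mono[OF _ i]) (use F G diff in \<open>auto simp: left_diff_distrib\<close>)
  also have "\<dots> = k * \<omega> * I (4 * r) + Cst * (I (8 * r) - I (2 * r))"
    unfolding I_def using r integrable_I[of "4 * r"] integrable_I[of "8 * r"] integrable_I[of "2 * r"]
    by (simp only: Bochner_Integration.integral_add Bochner_Integration.integral_diff
       Bochner_Integration.integrable_add Bochner_Integration.integrable_diff integrable_mult_right integral_mult_right_zero)
  also have "\<dots> \<le> k * \<omega> * I (4 * r) + Cst * (512 * K * \<epsilon>\<^sup>2 / r\<^sup>2 * I (4 * r))"
  proof -
    have "I (8 * r) - I (2 * r) \<le> 512 * K * \<epsilon>\<^sup>2 / r\<^sup>2 * I (2 * r)"
      by (rule tail_estimate) (use r in simp)
    also have "\<dots> \<le> 512 * K * \<epsilon>\<^sup>2 / r\<^sup>2 * I (4 * r)"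
      using I_mono[of "2 * r" "4 * r"] r K_nonneg by (intro mult_left_mono) auto
    finally show ?thesis using consts_nonneg(4) by (intro add_left_mono mult_left_mono)
  qed
  finally show ?thesis by (simp add: err_def algebra_simps)
qed

lemma deriv_terms_le:
  assumes "norm (A \<bullet> outer (g x)) \<le> k * (norm (g x))\<^sup>2" "\<bar>c\<bar> \<le> k"
  shows "\<bar>\<epsilon>\<^sup>2 * (A \<bullet> outer (g x)) + (u x)\<^sup>2 * c\<bar> \<le> k * dens x"
proof -
  have "\<epsilon>\<^sup>2 * \<bar>A \<bullet> outer (g x)\<bar> \<le> \<epsilon>\<^sup>2 * (k * (norm (g x))\<^sup>2)" "(u x)\<^sup>2 * \<bar>c\<bar> \<le> (u x)\<^sup>2 * k"
    using assms by (intro mult_left_mono; simp)+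
  then have "\<bar>\<epsilon>\<^sup>2 * (A \<bullet> outer (g x))\<bar> + \<bar>(u x)\<^sup>2 * c\<bar> \<le> k * dens x"
    by (simp add: abs_mult dens_def algebra_simps)
  then show ?thesis by linarith
qed

section \<open>The localized identities with coefficients frozen at \<open>z\<close>\<close>

lemma energy_limit:
  "\<bar>LINT x|lborel. ch x * (\<epsilon>\<^sup>2 * (J z \<bullet> outer (g x)) + (u x)\<^sup>2 * V z - u x powr (p + 1))\<bar>
    \<le> (1 * \<omega> + err) * I (4 * r)"
proof (rule integral_main_le)
  let ?F = "\<lambda>x. ch x * (\<epsilon>\<^sup>2 * ((J x *v g x) \<bullet> g x) + V x * (u x)\<^sup>2 - u x powr (p + 1))
    + \<epsilon>\<^sup>2 * (u x * ((J x *v g x) \<bullet> dch x))"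
  have d0: "dch x = 0" if "x \<notin> cball z (8 * r)" for x
    using grad_eq_0_outside[of z "8 * r" ch x] ch_props(5) that by (simp add: ch_props(2))
  have cd: "continuous_on UNIV dch" using C1_grad_continuous[OF ch_props(1)] unfolding ch_props(2) .
  show "integrable lborel ?F"
    by (intro integrable_compact_support[where z=z and R="8 * r"] continuous_intros cd) (simp add: d0 ch_props(5))
  show "(LINT x|lborel. ?F x) = 0"
    using energy_identity[OF ch_props(1) ch_props(5)] unfolding ch_props(2) .
  show "integrable lborel (\<lambda>x. ch x * (\<epsilon>\<^sup>2 * (J z \<bullet> outer (g x)) + (u x)\<^sup>2 * V z - u x powr (p + 1)))"
    by (intro integrable_compact_support[where z=z and R="8 * r"] continuous_intros) (simp add: ch_props(5))
  show "\<bar>?F x - ch x * (\<epsilon>\<^sup>2 * (J z \<bullet> outer (g x)) + (u x)\<^sup>2 * V z - u x powr (p + 1))\<bar>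
    \<le> 1 * \<omega> * (ch x * dens x) + Cst * ((cutoff z (8 * r) x - cutoff z (2 * r) x) * dens x)" for x
  proof -
    have "\<bar>ch x * (\<epsilon>\<^sup>2 * ((J x - J z) \<bullet> outer (g x)) + (u x)\<^sup>2 * (V x - V z))\<bar> \<le> \<omega> * (ch x * dens x)"
    proof (cases x rule: ch_cases)
      case 1 then show ?thesis by simp
    next
      case 2
      have "\<bar>\<epsilon>\<^sup>2 * ((J x - J z) \<bullet> outer (g x)) + (u x)\<^sup>2 * (V x - V z)\<bar> \<le> \<omega> * dens x"
        using near(1,2)[OF 2] by (intro deriv_terms_le) (auto intro: abs_inner_outer_le)
      from mult_left_mono[OF this ch_props(3)[of x]] show ?thesis
        using ch_props(3)[of x] by (simp add: abs_mult mult_ac)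
    qed
    moreover have "?F x - ch x * (\<epsilon>\<^sup>2 * (J z \<bullet> outer (g x)) + (u x)\<^sup>2 * V z - u x powr (p + 1))
      = ch x * (\<epsilon>\<^sup>2 * ((J x - J z) \<bullet> outer (g x)) + (u x)\<^sup>2 * (V x - V z)) + \<epsilon>\<^sup>2 * (u x * ((J x *v g x) \<bullet> dch x))"
      by (simp add: inner_diff_left inner_outer algebra_simps)
    ultimately show ?thesis using energy_dch_le[of x] by linarith
  qed
qed

text \<open>The field is constant near \<open>z\<close>, so the stress occurs only where
  \<open>ch\<close> varies. What survives is the derivative of the coefficients, with the factor
  \<open>- 1 / 2\<close> it has in \<open>poho\<close>.\<close>

lemma translation_limit:
  assumes b: "b \<in> Basis"
  shows "\<bar>LINT x|lborel. - (ch x * (\<epsilon>\<^sup>2 * (DJ z b \<bullet> outer (g x)) + (u x)\<^sup>2 * (b \<bullet> grad V z)) / 2)\<bar>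
    \<le> (1 * \<omega> + err) * I (4 * r)"
proof (rule integral_main_le)
  show "integrable lborel (poho b ch)"
    by (rule poho_integrable[OF ch_props(1) ch_props(5)])
  show "(LINT x|lborel. poho b ch x) = 0"
    by (rule pohozaev[OF ch_props(1), of z "8 * r"]) (use r in \<open>auto simp: ch_props(5)\<close>)
  show "integrable lborel (\<lambda>x. - (ch x * (\<epsilon>\<^sup>2 * (DJ z b \<bullet> outer (g x)) + (u x)\<^sup>2 * (b \<bullet> grad V z)) / 2))"
    by (rule integrable_compact_support[where z=z and R="8 * r"]) (auto intro!: continuous_intros simp: ch_props(5))
  show "\<bar>poho b ch x - - (ch x * (\<epsilon>\<^sup>2 * (DJ z b \<bullet> outer (g x)) + (u x)\<^sup>2 * (b \<bullet> grad V z)) / 2)\<bar>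
    \<le> 1 * \<omega> * (ch x * dens x) + Cst * ((cutoff z (8 * r) x - cutoff z (2 * r) x) * dens x)" for x
  proof -
    have "\<bar>ch x * (\<epsilon>\<^sup>2 * ((DJ x b - DJ z b) \<bullet> outer (g x)) + (u x)\<^sup>2 * (b \<bullet> grad V x - b \<bullet> grad V z))\<bar> \<le> \<omega> * (ch x * dens x)"
    proof (cases x rule: ch_cases)
      case 1 then show ?thesis by simp
    next
      case 2
      have "\<bar>\<epsilon>\<^sup>2 * ((DJ x b - DJ z b) \<bullet> outer (g x)) + (u x)\<^sup>2 * (b \<bullet> grad V x - b \<bullet> grad V z)\<bar> \<le> \<omega> * dens x"
        using near_deriv(1,2)[OF 2 b] by (intro deriv_terms_le) (auto intro: abs_inner_outer_le)
      from mult_left_mono[OF this ch_props(3)[of x]] show ?thesis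
        using ch_props(3)[of x] by (simp add: abs_mult mult_ac)
    qed
    moreover have "poho b ch x - - (ch x * (\<epsilon>\<^sup>2 * (DJ z b \<bullet> outer (g x)) + (u x)\<^sup>2 * (b \<bullet> grad V z)) / 2)
      = 1 * stress (J x) (V x) b (dch x) x
        - ch x * (\<epsilon>\<^sup>2 * ((DJ x b - DJ z b) \<bullet> outer (g x)) + (u x)\<^sup>2 * (b \<bullet> grad V x - b \<bullet> grad V z)) / 2"
      unfolding poho_eq_stress ch_props(2)
      by (simp add: inner_diff_left algebra_simps add_divide_distrib diff_divide_distrib)
    moreover have "\<bar>1 * stress (J x) (V x) b (dch x) x\<bar> \<le> Cst * ((cutoff z (8 * r) x - cutoff z (2 * r) x) * dens x)"
      by (rule stress_dch_le[OF b]) (use r in auto)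
    ultimately show ?thesis by linarith
  qed
qed

text \<open>The weight \<open>a \<bullet> (x - z)\<close> has gradient \<open>a\<close>, which
  extracts one entry of the stress tensor. The coefficient 3 leaves room for
  \<open>2 * \<omega>\<close> from freezing the stress and \<open>\<omega> / 2\<close> from the
  derivatives of the coefficients.\<close>

lemma stress_limit:
  assumes b: "b \<in> Basis" and a: "a \<in> Basis"
  shows "\<bar>LINT x|lborel. ch x * stress (J z) (V z) b a x\<bar> \<le> (3 * \<omega> + err) * I (4 * r)"
proof (rule integral_main_le)
  let ?l = "\<lambda>x. a \<bullet> (x - z)" and ?\<psi> = "\<lambda>x. ch x * (a \<bullet> (x - z))"
  have \<psi>: "C1 ?\<psi>" "grad ?\<psi> = (\<lambda>x. ch x *\<^sub>R a + ?l x *\<^sub>R dch x)"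
    by (rule C1_mult(1)[OF ch_props(1) C1_affine(1)])
      (simp only: C1_mult(2)[OF ch_props(1) C1_affine(1)] C1_affine(2) ch_props(2))
  show "integrable lborel (poho b ?\<psi>)"
    by (rule poho_integrable[OF \<psi>(1), of z "8 * r"]) (simp add: ch_props(5))
  show "(LINT x|lborel. poho b ?\<psi> x) = 0"
    by (rule pohozaev[OF \<psi>(1), of z "8 * r"]) (use r in \<open>auto simp: ch_props(5)\<close>)
  show "integrable lborel (\<lambda>x. ch x * stress (J z) (V z) b a x)"
    by (intro integrable_compact_support[where z=z and R="8 * r"] continuous_intros) (simp add: ch_props(5))
  show "\<bar>poho b ?\<psi> x - ch x * stress (J z) (V z) b a x\<bar>
    \<le> 3 * \<omega> * (ch x * dens x) + Cst * ((cutoff z (8 * r) x - cutoff z (2 * r) x) * dens x)" for x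
  proof -
    let ?P = "\<epsilon>\<^sup>2 * (DJ x b \<bullet> outer (g x)) + (u x)\<^sup>2 * (b \<bullet> grad V x)"
    let ?S = "stress (J x) (V x) b a x - stress (J z) (V z) b a x"
    have l: "\<bar>?l x\<bar> \<le> 8 * r" if "norm (x - z) \<le> 8 * r"
      using Cauchy_Schwarz_ineq2[of a "x - z"] a that by simp
    have "\<bar>ch x * (?S - ?l x * ?P / 2)\<bar> \<le> 3 * \<omega> * (ch x * dens x)"
    proof (cases x rule: ch_cases)
      case 1 then show ?thesis by simp
    next
      case 2
      have "\<bar>?l x * ?P\<bar> \<le> \<omega> * dens x"
      proof -
        have "\<bar>?l x\<bar> * norm (DJ x b) \<le> \<omega>" "\<bar>?l x\<bar> * \<bar>b \<bullet> grad V x\<bar> \<le> \<omega>"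
          using near_deriv(3,4)[OF 2 b] mult_right_mono[OF l[OF 2], of "norm (DJ x b)"]
            mult_right_mono[OF l[OF 2], of "\<bar>b \<bullet> grad V x\<bar>"] by auto
        then have "\<bar>\<epsilon>\<^sup>2 * ((?l x *\<^sub>R DJ x b) \<bullet> outer (g x)) + (u x)\<^sup>2 * (?l x * (b \<bullet> grad V x))\<bar> \<le> \<omega> * dens x"
          by (intro deriv_terms_le) (auto intro!: abs_inner_outer_le simp: abs_mult simp del: inner_scaleR_left)
        then show ?thesis by (simp add: algebra_simps)
      qed
      moreover have "\<bar>?S\<bar> \<le> 2 * \<omega> * dens x"
        using near(1,2)[OF 2] a b by (intro stress_diff_le) auto
      ultimately have "\<bar>?S - ?l x * ?P / 2\<bar> \<le> 3 * \<omega> * dens x" by linarith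
      from mult_left_mono[OF this ch_props(3)[of x]] show ?thesis
        using ch_props(3)[of x] by (simp add: abs_mult mult_ac)
    qed
    moreover have "poho b ?\<psi> x - ch x * stress (J z) (V z) b a x
      = ch x * (?S - ?l x * ?P / 2) + ?l x * stress (J x) (V x) b (dch x) x"
      unfolding poho_eq_stress \<psi>(2) stress_linear by (simp add: algebra_simps)
    moreover have "\<bar>?l x * stress (J x) (V x) b (dch x) x\<bar> \<le> Cst * ((cutoff z (8 * r) x - cutoff z (2 * r) x) * dens x)"
      by (rule stress_dch_le[OF b]) (use l in auto)
    ultimately show ?thesis by linarith
  qed
qed

text \<open>Once the coefficients are constants, the terms without the power of \<open>u\<close>
  depend on the solution only through one matrix and one number. This is what reduces the problem to
  finitely many dimensions.\<close>

lemma moment_integral: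
  "(LINT x|lborel. ch x * (\<epsilon>\<^sup>2 * (A \<bullet> outer (g x)) + (u x)\<^sup>2 * c))
    = A \<bullet> (LINT x|lborel. (ch x * \<epsilon>\<^sup>2) *\<^sub>R outer (g x)) + c * U (4 * r)"
proof -
  have 1: "integrable lborel (\<lambda>x. (ch x * \<epsilon>\<^sup>2) *\<^sub>R outer (g x))"
    by (intro integrable_compact_support[where z=z and R="8 * r"] continuous_intros) (simp add: ch_props(5))
  have 2: "integrable lborel (\<lambda>x. ch x * (u x)\<^sup>2)" using r by (intro integrable_U) simp
  have "ch x * (\<epsilon>\<^sup>2 * (A \<bullet> outer (g x)) + (u x)\<^sup>2 * c) = A \<bullet> ((ch x * \<epsilon>\<^sup>2) *\<^sub>R outer (g x)) + c * (ch x * (u x)\<^sup>2)" for x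
    by (simp add: algebra_simps)
  moreover have "integrable lborel (\<lambda>x. A \<bullet> ((ch x * \<epsilon>\<^sup>2) *\<^sub>R outer (g x)))"
    by (rule integrable_inner_right) (rule 1)
  moreover have "(LINT x|lborel. A \<bullet> ((ch x * \<epsilon>\<^sup>2) *\<^sub>R outer (g x))) = A \<bullet> (LINT x|lborel. (ch x * \<epsilon>\<^sup>2) *\<^sub>R outer (g x))"
    by (rule integral_inner_right) (rule 1)
  ultimately show ?thesis
    unfolding U_def using 2
    by (simp only: Bochner_Integration.integral_add integrable_mult_right integral_mult_right_zero)
qed

lemma I_pos: "I (4 * r) > 0"
proof -
  have "compact (cball z r)" "cball z r \<noteq> {}" using r by auto
  then obtain y where y: "\<And>x. x \<in> cball z r \<Longrightarrow> dens y \<le> dens x"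
    using continuous_attains_inf[of "cball z r" dens] continuous_on_subset[OF cont_dens] by blast
  have "0 < dens y * measure lborel (cball z r)"
    using dens_pos content_cball_pos[OF r, of z] by simp
  also have "\<dots> = (LINT x|lborel. dens y * indicator (cball z r) x)" by simp
  also have "\<dots> \<le> I (4 * r)"
    unfolding I_def
  proof (rule integral_mono)
    show "integrable lborel (\<lambda>x. dens y * indicator (cball z r) x)"
      by (intro integrable_mult_right integrable_real_indicator) (use emeasure_lborel_cball_finite[of z r] in auto)
    show "integrable lborel (\<lambda>x. ch x * dens x)" using r by (intro integrable_I) simp
    show "dens y * indicator (cball z r) x \<le> ch x * dens x" for x
    proof (cases "x \<in> cball z r")
      case True
      then have "ch x = 1" using r by (intro cutoff_eq_1) (auto simp: dist_norm norm_minus_commute)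
      then show ?thesis using y[OF True] True by simp
    next
      case False then show ?thesis using ch_props(3)[of x] dens_pos[of x] by simp
    qed
  qed
  finally show ?thesis .
qed

text \<open>Collects all that is retained of the solution. The assumption is
  \<open>err \<le> \<omega>\<close> with the definitions unfolded, so that it can be arranged before
  the index \<open>j\<close> is fixed. The bound \<open>6 * \<omega>\<close> is dictated by the
  stress identity.\<close>

lemma normalized_moments:
  assumes small_err: "(4 / r + 32) * (2 * \<Lambda> + W + \<alpha>) * (512 * (4 * \<Lambda>\<^sup>2 / (\<nu> * min \<nu> \<alpha>)) * \<epsilon>\<^sup>2 / r\<^sup>2) \<le> \<omega>"
  shows "\<exists>T B. norm T \<le> 1 \<and> 0 \<le> B \<and> B \<le> 1 \<and> T \<bullet> mat 1 + B = 1
    \<and> (\<forall>b\<in>Basis. \<bar>DJ z b \<bullet> T + (b \<bullet> grad V z) * B\<bar> \<le> 6 * \<omega>)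
    \<and> (\<forall>a\<in>Basis. \<forall>b\<in>Basis. \<bar>(J z *v a) \<bullet> (T *v b) - (a \<bullet> b) * (1/2 - 1 / (p + 1)) * (J z \<bullet> T + V z * B)\<bar> \<le> 6 * \<omega>)"
proof -
  let ?M = "I (4 * r)"
  define T where "T = (LINT x|lborel. (ch x * \<epsilon>\<^sup>2) *\<^sub>R outer (g x))"
  define B where "B = U (4 * r)"
  define q where "q = (LINT x|lborel. ch x * u x powr (p + 1))"
  note mom = moment_integral[folded T_def B_def]
  have M: "?M > 0" by (rule I_pos)
  have err: "err \<le> \<omega>" using small_err by (simp only: err_def Cst_def K_def)
  have int: "integrable lborel (\<lambda>x. ch x * (\<epsilon>\<^sup>2 * (A \<bullet> outer (g x)) + (u x)\<^sup>2 * c))" for A c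
    by (intro integrable_compact_support[where z=z and R="8 * r"] continuous_intros) (simp add: ch_props(5))
  have intq: "integrable lborel (\<lambda>x. ch x * u x powr (p + 1))"
    by (intro integrable_compact_support[where z=z and R="8 * r"] continuous_intros) (simp add: ch_props(5))
  have trace: "T \<bullet> mat 1 + B = ?M"
    using mom[of "mat 1" 1] unfolding I_def dens_def norm_sq_eq_inner_outer by (simp add: inner_commute)
  have B: "0 \<le> B" "B \<le> ?M"
    unfolding B_def using U_nonneg U_le_I[of "4 * r"] r by auto
  have T: "norm T \<le> ?M"
  proof -
    have "norm T \<le> (LINT x|lborel. norm ((ch x * \<epsilon>\<^sup>2) *\<^sub>R outer (g x)))"
      unfolding T_def by (rule integral_norm_bound)
    also have "\<dots> = (LINT x|lborel. ch x * (\<epsilon>\<^sup>2 * (mat 1 \<bullet> outer (g x)) + (u x)\<^sup>2 * 0))"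
      by (rule Bochner_Integration.integral_cong) (use ch_props(3) in \<open>auto simp: norm_outer norm_sq_eq_inner_outer abs_mult\<close>)
    also have "\<dots> = ?M - B" unfolding mom using trace by (simp add: inner_commute)
    finally show ?thesis using B by simp
  qed
  have split: "(LINT x|lborel. ch x * (\<epsilon>\<^sup>2 * (A \<bullet> outer (g x)) + (u x)\<^sup>2 * c - k * u x powr (p + 1)))
      = A \<bullet> T + c * B - k * q" for A c k
  proof -
    have "(LINT x|lborel. ch x * (\<epsilon>\<^sup>2 * (A \<bullet> outer (g x)) + (u x)\<^sup>2 * c - k * u x powr (p + 1)))
      = (LINT x|lborel. ch x * (\<epsilon>\<^sup>2 * (A \<bullet> outer (g x)) + (u x)\<^sup>2 * c) - k * (ch x * u x powr (p + 1)))"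
      by (simp only: right_diff_distrib mult.left_commute)
    also have "\<dots> = A \<bullet> T + c * B - k * q"
      unfolding mom[symmetric] q_def using int[of A c] intq by simp
    finally show ?thesis .
  qed
  have le: "(k * \<omega> + err) * ?M \<le> (k + 1) * \<omega> * ?M" for k
    using err M by (intro mult_right_mono) (auto simp: algebra_simps)
  \<comment> \<open>This controls the scalar \<open>q\<close>, the only quantity without a bound in
    terms of \<open>?M\<close>, and is used below to eliminate it.\<close>
  have R1: "\<bar>J z \<bullet> T + V z * B - q\<bar> \<le> 2 * \<omega> * ?M"
    using energy_limit split[of "J z" "V z" 1] le[of 1] by simp
  have R2: "\<bar>DJ z b \<bullet> T + (b \<bullet> grad V z) * B\<bar> \<le> 6 * \<omega> * ?M" if b: "b \<in> Basis" for b
  proof -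
    have "(LINT x|lborel. - (ch x * (\<epsilon>\<^sup>2 * (DJ z b \<bullet> outer (g x)) + (u x)\<^sup>2 * (b \<bullet> grad V z)) / 2))
      = - ((DJ z b \<bullet> T + (b \<bullet> grad V z) * B) / 2)"
      using mom[of "DJ z b" "b \<bullet> grad V z"] by simp
    moreover have "0 \<le> \<omega> * ?M" using consts_nonneg M by simp
    ultimately show ?thesis using translation_limit[OF b] le[of 1] by (simp add: mult.assoc)
  qed
  have R3: "\<bar>(J z *v a) \<bullet> (T *v b) - (a \<bullet> b) * (1/2 - 1 / (p + 1)) * (J z \<bullet> T + V z * B)\<bar> \<le> 6 * \<omega> * ?M"
    if a: "a \<in> Basis" and b: "b \<in> Basis" for a b
  proof -
    \<comment> \<open>The matrix against which \<open>T\<close> has to be paired in order to give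
      the gradient part of the stress entry for \<open>a\<close> and \<open>b\<close>; symmetry of
      \<open>J z\<close> moves it onto \<open>a\<close>.\<close>
    let ?A = "dyad (J z *v a) b - ((a \<bullet> b) / 2) *\<^sub>R J z"
    have "ch x * stress (J z) (V z) b a x = ch x * (\<epsilon>\<^sup>2 * (?A \<bullet> outer (g x)) + (u x)\<^sup>2 * (- (V z * (a \<bullet> b) / 2))
        - (- (a \<bullet> b) / (p + 1)) * u x powr (p + 1))" for x
      by (simp add: stress_def inner_diff_left dyad_inner outer_mult_vec inner_outer[of "J z"]
          J_inner_commute[of z "g x" a] inner_commute[of b a] inner_commute[of b "g x"] algebra_simps)
    then have "(LINT x|lborel. ch x * stress (J z) (V z) b a x)
        = ?A \<bullet> T + (- (V z * (a \<bullet> b) / 2)) * B - (- (a \<bullet> b) / (p + 1)) * q"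
      by (simp only: split)
    \<comment> \<open>Replacing \<open>q\<close> by \<open>J z \<bullet> T + V z * B\<close> turns
      the coefficients 1/2 and \<open>1 / (p + 1)\<close> into their difference; the price is the
      last term, bounded by \<open>R1\<close>.\<close>
    also have "\<dots> = (J z *v a) \<bullet> (T *v b) - (a \<bullet> b) * (1/2 - 1 / (p + 1)) * (J z \<bullet> T + V z * B)
        - (a \<bullet> b) / (p + 1) * (J z \<bullet> T + V z * B - q)"
      by (simp add: inner_diff_left dyad_inner algebra_simps diff_divide_distrib add_divide_distrib)
    finally have eq: "(J z *v a) \<bullet> (T *v b) - (a \<bullet> b) * (1/2 - 1 / (p + 1)) * (J z \<bullet> T + V z * B)
      = (LINT x|lborel. ch x * stress (J z) (V z) b a x) + (a \<bullet> b) / (p + 1) * (J z \<bullet> T + V z * B - q)" by simp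
    have "\<bar>a \<bullet> b\<bar> \<le> 1" using Cauchy_Schwarz_ineq2[of a b] a b by simp
    then have "\<bar>(a \<bullet> b) / (p + 1)\<bar> \<le> 1" using p by (simp add: abs_divide)
    then have "\<bar>(a \<bullet> b) / (p + 1) * (J z \<bullet> T + V z * B - q)\<bar> \<le> 1 * (2 * \<omega> * ?M)"
      unfolding abs_mult by (intro mult_mono R1) auto
    then have "\<bar>(LINT x|lborel. ch x * stress (J z) (V z) b a x) + (a \<bullet> b) / (p + 1) * (J z \<bullet> T + V z * B - q)\<bar>
        \<le> (3 + 1) * \<omega> * ?M + 1 * (2 * \<omega> * ?M)"
      by (intro order_trans[OF abs_triangle_ineq] add_mono order_trans[OF stress_limit[OF b a] le[of 3]])
    also have "\<dots> = 6 * \<omega> * ?M" by simp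
    finally show ?thesis unfolding eq .
  qed
  have scale: "\<bar>x\<bar> / ?M \<le> k" if "\<bar>x\<bar> \<le> k * ?M" for x k
    using that M by (simp add: field_simps)
  show ?thesis
  proof (intro exI[of _ "T /\<^sub>R ?M"] exI[of _ "B / ?M"] conjI ballI)
    show "norm (T /\<^sub>R ?M) \<le> 1" using T M by (simp add: field_simps)
    show "0 \<le> B / ?M" "B / ?M \<le> 1" using B M by auto
    show "(T /\<^sub>R ?M) \<bullet> mat 1 + B / ?M = 1"
      using trace M by (simp add: field_simps)
    fix b :: "real^'n" assume b: "b \<in> Basis"
    have "DJ z b \<bullet> (T /\<^sub>R ?M) + (b \<bullet> grad V z) * (B / ?M) = (DJ z b \<bullet> T + (b \<bullet> grad V z) * B) / ?M"
      using M by (simp add: field_simps)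
    then show "\<bar>DJ z b \<bullet> (T /\<^sub>R ?M) + (b \<bullet> grad V z) * (B / ?M)\<bar> \<le> 6 * \<omega>"
      using scale[OF R2[OF b]] M by simp
  next
    fix a b :: "real^'n" assume a: "a \<in> Basis" and b: "b \<in> Basis"
    have "(J z *v a) \<bullet> ((T /\<^sub>R ?M) *v b) - (a \<bullet> b) * (1/2 - 1 / (p + 1)) * (J z \<bullet> (T /\<^sub>R ?M) + V z * (B / ?M))
      = ((J z *v a) \<bullet> (T *v b) - (a \<bullet> b) * (1/2 - 1 / (p + 1)) * (J z \<bullet> T + V z * B)) / ?M"
    proof -
      have "(T /\<^sub>R ?M) *v b = (T *v b) /\<^sub>R ?M"
        by (simp add: scaleR_matrix_vector_assoc)
      moreover have "inverse m * P - d * (inverse m * Q + v * (\<beta> / m)) = (P - d * (Q + v * \<beta>)) / m" if "m > 0" for m P d Q v \<beta> :: real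
        using that by (simp add: field_simps)
      ultimately show ?thesis using M by (simp only: inner_scaleR_right)
    qed
    then show "\<bar>(J z *v a) \<bullet> ((T /\<^sub>R ?M) *v b) - (a \<bullet> b) * (1/2 - 1 / (p + 1)) * (J z \<bullet> (T /\<^sub>R ?M) + V z * (B / ?M))\<bar> \<le> 6 * \<omega>"
      using scale[OF R3[OF a b]] M by simp
  qed
qed

end

section \<open>Jacobi's formula and the critical point equation\<close>

text \<open>The product rule in the Leibniz formula yields a sum of determinants in which one row of
  \<open>A\<close> is replaced by the same row of \<open>H\<close>; Cramer's rule evaluates each of
  them. The inverse is given as \<open>B\<close> because the application has \<open>T\<close>
  divided by \<kappa> in that role.\<close>

lemma has_derivative_det:
  fixes A B :: "real^'n^'n"
  assumes AB: "A ** B = mat 1"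
  shows "(det has_derivative (\<lambda>H. det A * trace (H ** B))) (at A)"
proof -
  let ?U = "UNIV :: 'n set"
  let ?P = "{p. p permutes ?U}"
  let ?R = "\<lambda>H k. (\<chi> i. if i = k then H $ k else A $ i) :: real^'n^'n"
  have row: "det (?R H k) = (H ** B) $ k $ k * det A" for H k
  proof -
    have BA: "B ** A = mat 1" using AB by (simp add: matrix_left_right_inverse)
    \<comment> \<open>Since \<open>H = (H ** B) ** A\<close>, row \<open>k\<close> of
      \<open>H\<close> is a combination of the rows of \<open>A\<close> with coefficients from row
      \<open>k\<close> of \<open>H ** B\<close>; only the coefficient of row \<open>k\<close> itself
      affects the determinant.\<close>
    have "(\<Sum>i\<in>?U. (H ** B) $ k $ i *s row i A) = ((H ** B) ** A) $ k"
      by (simp add: vec_eq_iff matrix_matrix_mult_def[of "H ** B" A] row_def)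
    also have "(H ** B) ** A = H" by (simp add: matrix_mul_assoc[symmetric] BA)
    finally have "?R H k = (\<chi> i. if i = k then (\<Sum>i\<in>?U. (H ** B) $ k $ i *s row i A) else row i A)"
      by (simp add: vec_eq_iff row_def)
    then show ?thesis using cramer_lemma_transpose[of k "(H ** B) $ k" A] by simp
  qed
  have expand: "det (?R H k) = (\<Sum>q\<in>?P. of_int (sign q) * (H $ k $ q k * (\<Prod>j\<in>?U - {k}. A $ j $ q j)))" for H k
    unfolding det_def
  proof (rule sum.cong[OF refl])
    fix q
    have "(\<Prod>i\<in>?U. ?R H k $ i $ q i) = ?R H k $ k $ q k * (\<Prod>i\<in>?U - {k}. ?R H k $ i $ q i)"
      by (rule prod.remove) auto
    also have "(\<Prod>i\<in>?U - {k}. ?R H k $ i $ q i) = (\<Prod>j\<in>?U - {k}. A $ j $ q j)"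
      by (rule prod.cong) auto
    finally show "of_int (sign q) * (\<Prod>i\<in>?U. ?R H k $ i $ q i)
        = of_int (sign q) * (H $ k $ q k * (\<Prod>j\<in>?U - {k}. A $ j $ q j))" by simp
  qed
  have nth: "((\<lambda>X :: real^'n^'n. X $ i $ j) has_derivative (\<lambda>H. H $ i $ j)) (at A)" for i j
    by (intro bounded_linear_imp_has_derivative bounded_linear_compose[OF bounded_linear_vec_nth] bounded_linear_vec_nth)
  have "(det has_derivative (\<lambda>H. \<Sum>q\<in>?P. of_int (sign q) * (\<Sum>i\<in>?U. H $ i $ q i * (\<Prod>j\<in>?U - {i}. A $ j $ q j)))) (at A)"
    unfolding det_def
    by (intro has_derivative_sum has_derivative_mult_right has_derivative_prod nth)
  moreover have "(\<Sum>q\<in>?P. of_int (sign q) * (\<Sum>i\<in>?U. H $ i $ q i * (\<Prod>j\<in>?U - {i}. A $ j $ q j))) = det A * trace (H ** B)" for H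
  proof -
    have "(\<Sum>q\<in>?P. of_int (sign q) * (\<Sum>i\<in>?U. H $ i $ q i * (\<Prod>j\<in>?U - {i}. A $ j $ q j)))
      = (\<Sum>i\<in>?U. \<Sum>q\<in>?P. of_int (sign q) * (H $ i $ q i * (\<Prod>j\<in>?U - {i}. A $ j $ q j)))"
      by (subst sum.swap) (simp add: sum_distrib_left)
    also have "\<dots> = (\<Sum>i\<in>?U. (H ** B) $ i $ i * det A)"
      by (simp only: expand[symmetric] row)
    finally show ?thesis by (simp add: trace_def sum_distrib_left mult.commute)
  qed
  ultimately show ?thesis by simp
qed

lemma matrix_mult_scaleR:
  fixes A B :: "real^'n^'n"
  shows "A ** (k *\<^sub>R B) = k *\<^sub>R (A ** B)" "(k *\<^sub>R A) ** B = k *\<^sub>R (A ** B)"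
  by (simp_all add: matrix_scalar_ac flip: scalar_matrix_assoc)

lemma inner_eq_trace: "A \<bullet> B = trace (A ** transpose (B :: real^'n^'n))"
  by (simp add: trace_def matrix_matrix_mult_def transpose_def inner_vec_def)

lemma inner_eq_trace_transpose: "A \<bullet> B = trace (transpose (A :: real^'n^'n) ** B)"
  unfolding trace_def matrix_matrix_mult_def transpose_def inner_vec_def by (simp, subst sum.swap, simp)

lemma critical_point_of_moments:
  fixes V :: "real^'n \<Rightarrow> real" and J :: "real^'n \<Rightarrow> real^'n^'n"
  assumes V: "C1 V" "V z > 0" and J: "C1 J" "transpose (J z) = J z" "\<And>\<xi>. J z *v \<xi> = 0 \<Longrightarrow> \<xi> = 0" and p: "p > 1"
    and norm: "T \<bullet> mat 1 + B = 1"
    and transl: "\<And>b. b \<in> Basis \<Longrightarrow> frechet_derivative J (at z) b \<bullet> T + (b \<bullet> grad V z) * B = 0"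
    and stress: "\<And>a b. a \<in> Basis \<Longrightarrow> b \<in> Basis \<Longrightarrow>
      (J z *v a) \<bullet> (T *v b) = (a \<bullet> b) * (1/2 - 1 / (p + 1)) * (J z \<bullet> T + V z * B)"
  shows "critical_point (Gamma_fun J V p) z"
proof -
  let ?c = "1/2 - 1 / (p + 1)" and ?N = "real CARD('n)" and ?DJ = "frechet_derivative J (at z)"
  define \<kappa> where "\<kappa> = ?c * (J z \<bullet> T + V z * B)"
  define \<gamma> where "\<gamma> = (p + 1) / (p - 1) - ?N / 2"
  have c: "?c = (p - 1) / (2 * (p + 1))" "?c \<noteq> 0" using p by (auto simp: field_simps)
  have JT: "J z ** T = \<kappa> *\<^sub>R mat 1"
  proof -
    have "(J z ** T) $ i $ j = (\<kappa> *\<^sub>R mat 1) $ i $ j" for i j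
    proof -
      have "(J z ** T) $ i $ j = axis i 1 \<bullet> ((J z ** T) *v axis j 1)"
        by (simp add: inner_axis' matrix_vector_mul_component inner_axis)
      also have "\<dots> = (J z *v axis i 1) \<bullet> (T *v axis j 1)"
        by (metis J(2) dot_lmul_matrix matrix_vector_mul_assoc transpose_matrix_vector)
      also have "\<dots> = (axis i 1 \<bullet> (axis j 1 :: real^'n)) * \<kappa>"
        unfolding \<kappa>_def by (subst stress) (auto simp: axis_in_Basis_iff)
      also have "\<dots> = (\<kappa> *\<^sub>R mat 1) $ i $ j"
        by (simp add: mat_def inner_axis_axis)
      finally show ?thesis .
    qed
    then show ?thesis by (simp add: vec_eq_iff)
  qed
  have tr: "J z \<bullet> T = ?N * \<kappa>"
  proof -
    have "J z \<bullet> T = trace (J z ** T)"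
      using inner_eq_trace_transpose[of "J z" T] J(2) by simp
    then show ?thesis by (simp add: JT trace_def mat_def)
  qed
  \<comment> \<open>If it were 0, the definition of \<kappa> would give \<open>B = 0\<close> and
    injectivity of \<open>J z\<close> would give \<open>T = 0\<close>, against the
    normalization.\<close>
  have \<kappa>: "\<kappa> \<noteq> 0"
  proof
    assume 0: "\<kappa> = 0"
    then have "?N * \<kappa> + V z * B = 0" using \<kappa>_def c(2) unfolding tr by (metis mult_eq_0_iff)
    then have "B = 0" using 0 V(2) by simp
    have "T *v x = 0" for x
    proof (rule J(3))
      have "J z *v (T *v x) = (J z ** T) *v x" by (simp add: matrix_vector_mul_assoc)
      then show "J z *v (T *v x) = 0" by (simp add: JT 0)
    qed
    then have "T = 0" by (simp add: matrix_eq)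
    then show False using norm \<open>B = 0\<close> by simp
  qed
  have T_sym: "transpose T = T"
  proof -
    \<comment> \<open>One triple product evaluated in two ways; both inner products of matrices are
      multiples of the identity.\<close>
    have "transpose T ** (J z ** T) = transpose (J z ** T) ** T"
      by (simp add: matrix_transpose_mul J(2) matrix_mul_assoc)
    then have "\<kappa> *\<^sub>R transpose T = \<kappa> *\<^sub>R T"
      unfolding JT by (simp add: transpose_scalar matrix_mult_scaleR)
    then show ?thesis using \<kappa> by simp
  qed
  \<comment> \<open>Inserting the trace \<open>?N * \<kappa>\<close> into the definition of \<kappa>
    leaves a linear equation for \<open>V z * B\<close>. Its solution carries twice the exponent of
    \<open>V\<close> in \<open>Gamma_fun\<close>, and this is how that exponent arises.\<close>
  have VB: "V z * B = 2 * \<kappa> * \<gamma>"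
  proof -
    have "\<kappa> * (2 * (p + 1)) = (p - 1) * (?N * \<kappa> + V z * B)"
      using \<kappa>_def p unfolding tr c(1) by (simp add: field_simps)
    then have "V z * B = \<kappa> * (2 * (p + 1)) / (p - 1) - ?N * \<kappa>" using p by (simp add: field_simps)
    also have "\<dots> = 2 * \<kappa> * \<gamma>" using p by (simp add: \<gamma>_def field_simps)
    finally show ?thesis .
  qed
  have inv: "J z ** (T /\<^sub>R \<kappa>) = mat 1"
    using JT \<kappa> by (simp add: matrix_mult_scaleR)
  have det: "det (J z) \<noteq> 0"
    using inv by (metis invertible_det_nz invertible_right_inverse)
  have dV: "(V has_derivative (\<lambda>h. h \<bullet> grad V z)) (at z)"
    by (rule C1_grad_derivative[OF V(1)])
  have dJ: "(J has_derivative ?DJ) (at z)" by (rule C1_frechet(1)[OF J(1)])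
  let ?D = "\<lambda>h. det (J z) * trace (?DJ h ** (T /\<^sub>R \<kappa>))"
  have ddet: "((\<lambda>x. det (J x)) has_derivative ?D) (at z)"
    by (rule has_derivative_compose[OF dJ has_derivative_det[OF inv]])
  \<comment> \<open>The quotient is written in a form valid for both signs of the determinant,
    \<open>sqrt\<close> being an odd function; at this point the determinant is only known to be
    nonzero.\<close>
  have dsqrt: "(sqrt has_real_derivative sqrt (det (J z)) / (2 * det (J z))) (at (det (J z)))"
    using det by (rule DERIV_real_sqrt_generic) (auto simp: field_simps real_sqrt_minus)
  have dV2: "((\<lambda>x. V x powr \<gamma>) has_derivative (\<lambda>h. V z powr \<gamma> * (\<gamma> * (h \<bullet> grad V z) / V z))) (at z)"
    by (rule has_derivative_eq_rhs[OF has_derivative_powr[OF dV has_derivative_const]])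
      (use V(2) in \<open>auto simp: mult_ac\<close>)
  let ?L = "\<lambda>h. V z powr \<gamma> * (sqrt (det (J z)) / (2 * det (J z)) * ?D h)
      + V z powr \<gamma> * (\<gamma> * (h \<bullet> grad V z) / V z) * sqrt (det (J z))"
  have L: "(Gamma_fun J V p has_derivative ?L) (at z)"
    unfolding Gamma_fun_def \<gamma>_def[symmetric]
    by (rule has_derivative_mult[OF dV2 has_derivative_compose[OF ddet dsqrt[unfolded has_field_derivative_def]]])
  have "?L b = 0" if b: "b \<in> Basis" for b
  proof -
    have "trace (?DJ b ** (T /\<^sub>R \<kappa>)) = (?DJ b \<bullet> T) / \<kappa>"
      using inner_eq_trace[of "?DJ b" "T /\<^sub>R \<kappa>"] by (simp add: T_sym transpose_scalar divide_inverse mult.commute)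
    also have "?DJ b \<bullet> T = - ((b \<bullet> grad V z) * (2 * \<kappa> * \<gamma> / V z))"
    proof -
      have "B = 2 * \<kappa> * \<gamma> / V z" using VB V(2) by (simp add: field_simps)
      then show ?thesis using transl[OF b] by simp
    qed
    finally have "?D b = - (det (J z) * ((b \<bullet> grad V z) * (2 * \<gamma> / V z)))"
      using \<kappa> by simp
    then show ?thesis using det by (simp add: field_simps)
  qed
  moreover have "linear ?L" using has_derivative_linear[OF L] .
  ultimately have "?L = (\<lambda>h. 0)"
    using linear_eq_stdbasis[of ?L "\<lambda>h. 0"] by (auto simp: linear_zero)
  then show ?thesis
    using L by (simp add: critical_point_def gderiv_def)
qed

section \<open>Choice of the parameters and passage to the limit\<close>

theorem theorem1p2:
  fixes V :: "real^'n \<Rightarrow> real"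
    and J :: "real^'n \<Rightarrow> real^'n^'n"
    and p \<alpha> \<nu> :: real
    and z0 :: "real^'n"
    and \<epsilon> :: "nat \<Rightarrow> real"
    and u :: "nat \<Rightarrow> real^'n \<Rightarrow> real"
  assumes N: "CARD('n) \<ge> 3"
    and p: "1 < p" "p < (real CARD('n) + 2) / (real CARD('n) - 2)"
    and V: "C1 V" "bdd_above (range V)" "bdd_below (range V)" "(INF x. V x) = \<alpha>" "\<alpha> > 0"
    and J: "C1 J" "bounded (range J)" "\<And>x. transpose (J x) = J x"
    and J_elliptic: "\<nu> > 0" "\<And>x \<xi>. \<xi> \<noteq> 0 \<Longrightarrow> (J x *v \<xi>) \<bullet> \<xi> \<ge> \<nu> * (norm \<xi>)\<^sup>2"
    and eps: "\<And>j. \<epsilon> j > 0" "\<epsilon> \<longlonglongrightarrow> 0"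
    and sol: "\<And>j. is_solution (\<epsilon> j) J V p (u j)"
    and conc: "\<And>\<eta>. \<eta> > 0 \<Longrightarrow>
      \<exists>\<rho>>0. \<exists>j0>0. \<forall>j\<ge>j0. \<forall>x. norm (x - z0) \<ge> \<epsilon> j * \<rho> \<longrightarrow> u j x \<le> \<eta>"
  shows "critical_point (Gamma_fun J V p) z0"
proof -
  let ?DJ = "\<lambda>x. frechet_derivative J (at x)"
  let ?Q = "\<lambda>\<omega> T B. norm T \<le> 1 \<and> 0 \<le> B \<and> B \<le> 1 \<and> T \<bullet> mat 1 + B = 1
    \<and> (\<forall>b\<in>Basis. \<bar>?DJ z0 b \<bullet> T + (b \<bullet> grad V z0) * B\<bar> \<le> 6 * \<omega>)
    \<and> (\<forall>a\<in>Basis. \<forall>b\<in>Basis. \<bar>(J z0 *v a) \<bullet> (T *v b) - (a \<bullet> b) * (1/2 - 1 / (p + 1)) * (J z0 \<bullet> T + V z0 * B)\<bar> \<le> 6 * \<omega>)"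
  have V_ge: "\<alpha> \<le> V x" for x
    using cINF_lower[OF V(3), of x] V(4) by simp
  have elliptic: "\<nu> * (norm \<xi>)\<^sup>2 \<le> (J x *v \<xi>) \<bullet> \<xi>" for x \<xi>
    using J_elliptic(2)[of \<xi> x] by (cases "\<xi> = 0") auto
  have psd: "0 \<le> (J x *v \<xi>) \<bullet> \<xi>" for x \<xi>
    by (rule order_trans[OF _ elliptic]) (use J_elliptic(1) in simp)
  obtain \<Lambda> where \<Lambda>: "norm (J x) \<le> \<Lambda>" for x
    using J(2) unfolding bounded_iff by blast
  have near_z0: "\<forall>\<^sub>F x in nhds z0. dist (f x) (f z0) < \<omega>" if "continuous_on UNIV f" "\<omega> > 0"
    for f :: "real^'n \<Rightarrow> 'b::metric_space" and \<omega>
  proof -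
    have "(f \<longlongrightarrow> f z0) (nhds z0)"
      using that(1) by (simp add: continuous_on_eq_continuous_at isCont_def flip: tendsto_at_iff_tendsto_nhds)
    then show ?thesis using that(2) by (rule tendstoD)
  qed
  \<comment> \<open>A single index \<open>j\<close> is enough for each \<omega>: the moments of one
    solution that is concentrated well enough satisfy the identities up to
    \<open>6 * \<omega>\<close>.\<close>
  have approx: "\<exists>T B. ?Q \<omega> T B" if \<omega>: "\<omega> > 0" for \<omega>
  proof -
    have "\<forall>\<^sub>F x in nhds z0. dist (J x) (J z0) < \<omega> \<and> dist (V x) (V z0) < \<omega>
        \<and> (\<forall>b\<in>Basis. dist (?DJ x b) (?DJ z0 b) < \<omega>) \<and> (\<forall>b\<in>Basis. dist (b \<bullet> grad V x) (b \<bullet> grad V z0) < \<omega>)"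
      by (intro eventually_conj eventually_ball_finite ballI near_z0 \<omega> finite_Basis
          C1_continuous[OF J(1)] C1_continuous[OF V(1)] C1_frechet(2)[OF J(1)]
          continuous_intros C1_grad_continuous[OF V(1)])
    then obtain d where d: "d > 0" and near: "\<And>x. dist x z0 < d \<Longrightarrow> dist (J x) (J z0) < \<omega> \<and> dist (V x) (V z0) < \<omega>
        \<and> (\<forall>b\<in>Basis. dist (?DJ x b) (?DJ z0 b) < \<omega>) \<and> (\<forall>b\<in>Basis. dist (b \<bullet> grad V x) (b \<bullet> grad V z0) < \<omega>)"
      unfolding eventually_nhds_metric by blast
    \<comment> \<open>A bound on the ball of radius \<open>d\<close> for the directional derivatives
      of \<open>J\<close> and \<open>V\<close>: their size at \<open>z0\<close> plus their
      oscillation.\<close>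
    define L where "L = \<omega> + (\<Sum>b\<in>Basis. norm (?DJ z0 b) + \<bar>b \<bullet> grad V z0\<bar>)"
    \<comment> \<open>The first entry keeps \<open>8 * r\<close> below \<open>d\<close>, the second
      makes \<open>8 * r * L\<close> at most \<omega>; adding 1 to \<open>L\<close> excludes a zero
      denominator.\<close>
    define r where "r = min (d / 16) (\<omega> / (8 * (L + 1)))"
    define W where "W = \<bar>V z0\<bar> + \<omega>"
    have L: "L \<ge> 0" unfolding L_def using \<omega> by (intro add_nonneg_nonneg sum_nonneg) auto
    have L_ge: "norm (?DJ z0 b) + \<omega> \<le> L" "\<bar>b \<bullet> grad V z0\<bar> + \<omega> \<le> L" if "b \<in> Basis" for b
    proof -
      have "norm (?DJ z0 b) + \<bar>b \<bullet> grad V z0\<bar> \<le> L - \<omega>"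
        using member_le_sum[OF that, of "\<lambda>b. norm (?DJ z0 b) + \<bar>b \<bullet> grad V z0\<bar>"] unfolding L_def by auto
      then show "norm (?DJ z0 b) + \<omega> \<le> L" "\<bar>b \<bullet> grad V z0\<bar> + \<omega> \<le> L"
        using norm_ge_zero[of "?DJ z0 b"] abs_ge_zero[of "b \<bullet> grad V z0"] by linarith+
    qed
    have r: "r > 0" unfolding r_def using d \<omega> L by simp
    have r8: "8 * r * t \<le> \<omega>" if "t \<le> L" for t
    proof -
      have "r \<le> \<omega> / (8 * (L + 1))" unfolding r_def by simp
      then have "8 * r \<le> \<omega> / (L + 1)" using L by (simp add: field_simps)
      then have "8 * r * t \<le> 8 * r * L" using that r by (intro mult_left_mono) auto
      also have "\<dots> \<le> \<omega> / (L + 1) * L" using \<open>8 * r \<le> \<omega> / (L + 1)\<close> L by (rule mult_right_mono)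
      also have "\<dots> \<le> \<omega>" using L \<omega> by (simp add: field_simps)
      finally show ?thesis .
    qed
    have ball: "dist x z0 < d" if "norm (x - z0) \<le> 8 * r" for x
    proof -
      have "r \<le> d / 16" unfolding r_def by (rule min.cobounded1)
      then show ?thesis using that d by (simp add: dist_norm)
    qed
    \<comment> \<open>Chosen so that \<open>\<eta> powr (p - 1)\<close> is
      \<open>\<alpha> / 2\<close>, the threshold of \<open>small\<close>.\<close>
    define \<eta> where "\<eta> = (\<alpha> / 2) powr (1 / (p - 1))"
    have "\<eta> > 0" unfolding \<eta>_def using V(5) by simp
    then obtain \<rho> j0 where \<rho>: "\<And>j x. j \<ge> j0 \<Longrightarrow> norm (x - z0) \<ge> \<epsilon> j * \<rho> \<Longrightarrow> u j x \<le> \<eta>"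
      using conc by meson
    let ?c = "(4 / r + 32) * (2 * \<Lambda> + W + \<alpha>)" and ?k = "512 * (4 * \<Lambda>\<^sup>2 / (\<nu> * min \<nu> \<alpha>))"
    have "(\<lambda>j. ?c * (?k * (\<epsilon> j)\<^sup>2 / r\<^sup>2)) \<longlonglongrightarrow> ?c * (?k * 0\<^sup>2 / r\<^sup>2)"
      by (intro tendsto_mult tendsto_divide tendsto_power tendsto_const eps(2)) (use r in auto)
    then have "(\<lambda>j. ?c * (?k * (\<epsilon> j)\<^sup>2 / r\<^sup>2)) \<longlonglongrightarrow> 0" by simp
    then have e1: "\<forall>\<^sub>F j in sequentially. ?c * (?k * (\<epsilon> j)\<^sup>2 / r\<^sup>2) < \<omega>"
      using \<omega> by (rule order_tendstoD)
    \<comment> \<open>Concentration is known at the scale \<epsilon>; eventually the radius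
      \<open>\<epsilon> j * \<rho>\<close> is below the fixed \<open>r\<close>, so smallness holds
      at all distances from \<open>r\<close> on.\<close>
    have "(\<lambda>j. \<epsilon> j * \<rho>) \<longlonglongrightarrow> 0 * \<rho>" by (intro tendsto_intros eps(2))
    then have e2: "\<forall>\<^sub>F j in sequentially. \<epsilon> j * \<rho> < r" using r by (intro order_tendstoD) auto
    have e3: "\<forall>\<^sub>F j in sequentially. \<epsilon> j < 1" using eps(2) by (rule order_tendstoD) simp
    have "\<exists>j. j \<ge> j0 \<and> ?c * (?k * (\<epsilon> j)\<^sup>2 / r\<^sup>2) < \<omega> \<and> \<epsilon> j * \<rho> < r \<and> \<epsilon> j < 1"
      using eventually_happens'[OF _ eventually_conj[OF eventually_ge_at_top[of j0] eventually_conj[OF e1 eventually_conj[OF e2 e3]]]]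
      by simp
    then obtain j where j: "j \<ge> j0" "?c * (?k * (\<epsilon> j)\<^sup>2 / r\<^sup>2) < \<omega>" "\<epsilon> j * \<rho> < r" "\<epsilon> j < 1"
      by blast
    have pos: "u j x > 0" for x using sol[of j] by (simp add: is_solution_def)
    interpret local_solution V J p "\<epsilon> j" "u j" \<Lambda> \<nu> \<alpha> r z0 \<omega> W
    proof
      show "norm (x - z0) \<ge> r \<Longrightarrow> u j x powr (p - 1) \<le> \<alpha> / 2" for x
      proof -
        assume "norm (x - z0) \<ge> r"
        then have "u j x \<le> \<eta>" using j by (intro \<rho>) auto
        then have "u j x powr (p - 1) \<le> \<eta> powr (p - 1)"
          using pos[of x] p by (intro powr_mono2) auto
        also have "\<dots> = \<alpha> / 2" unfolding \<eta>_def using p V(5) by (simp add: powr_powr)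
        finally show ?thesis .
      qed
      fix x assume x: "norm (x - z0) \<le> 8 * r"
      note n = near[OF ball[OF x]]
      show "norm (J x - J z0) \<le> \<omega>" "\<bar>V x - V z0\<bar> \<le> \<omega>" "\<bar>V x\<bar> \<le> W"
        using n by (auto simp: dist_norm W_def)
      fix b :: "real^'n" assume b: "b \<in> Basis"
      show DJ: "norm (?DJ x b - ?DJ z0 b) \<le> \<omega>" and dV: "\<bar>b \<bullet> grad V x - b \<bullet> grad V z0\<bar> \<le> \<omega>"
        using n b by (auto simp: dist_norm intro: less_imp_le)
      show "8 * r * norm (?DJ x b) \<le> \<omega>"
        using DJ L_ge(1)[OF b] norm_triangle_sub[of "?DJ x b" "?DJ z0 b"] by (intro r8) linarith
      show "8 * r * \<bar>b \<bullet> grad V x\<bar> \<le> \<omega>"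
        using dV L_ge(2)[OF b] by (intro r8) linarith
    qed (use V J J_elliptic(1) \<Lambda> elliptic psd p eps(1) sol V_ge r j(4) in auto)
    show ?thesis by (rule normalized_moments) (use j(2) in simp)
  qed
  \<comment> \<open>The two moments are kept as one pair so that one extraction from a compact
    product makes both converge.\<close>
  define X where "X n = (SOME X. ?Q (inverse (real (Suc n))) (fst X) (snd X))" for n
  have X: "?Q (inverse (real (Suc n))) (fst (X n)) (snd (X n))" for n
  proof -
    have "\<exists>X. ?Q (inverse (real (Suc n))) (fst X) (snd X)"
      using approx[of "inverse (real (Suc n))"] by auto
    then show ?thesis unfolding X_def by (rule someI_ex)
  qed
  have "compact (cball (0 :: real^'n^'n) 1 \<times> {0..1::real})"
    by (intro compact_Times compact_cball compact_Icc)
  moreover have "X n \<in> cball 0 1 \<times> {0..1}" for n using X[of n] by (cases "X n") auto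
  ultimately obtain l s where s: "strict_mono (s :: nat \<Rightarrow> nat)" and lim: "(X \<circ> s) \<longlonglongrightarrow> l"
    unfolding compact_def by metis
  \<comment> \<open>Each approximate identity is the smallness of a continuous function of the pair,
    hence it becomes exact at the limit \<open>l\<close>; the normalization is the case in which the
    error is 0 throughout.\<close>
  have exact: "f l = 0" if f: "continuous_on UNIV f" "\<And>n. \<bar>f (X n)\<bar> \<le> 6 * inverse (real (Suc n))"
    for f :: "(real^'n^'n) \<times> real \<Rightarrow> real"
  proof (rule LIMSEQ_unique)
    show "(\<lambda>n. f (X (s n))) \<longlonglongrightarrow> f l"
      using continuous_on_tendsto_compose[OF f(1) lim] by (simp add: o_def)
    show "(\<lambda>n. f (X (s n))) \<longlonglongrightarrow> 0"
    proof (rule Lim_null_comparison)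
      have "\<bar>f (X (s n))\<bar> \<le> 6 * inverse (real (Suc n))" for n
      proof -
        have "inverse (real (Suc (s n))) \<le> inverse (real (Suc n))"
          using seq_suble[OF s, of n] by (intro le_imp_inverse_le) auto
        then show ?thesis using f(2)[of "s n"] by linarith
      qed
      then show "\<forall>\<^sub>F n in sequentially. norm (f (X (s n))) \<le> 6 * inverse (real (Suc n))"
        by simp
      show "(\<lambda>n. 6 * inverse (real (Suc n))) \<longlonglongrightarrow> 0"
        using tendsto_mult_right_zero[OF LIMSEQ_inverse_real_of_nat] .
    qed
  qed
  show ?thesis
  proof (rule critical_point_of_moments[of V z0 J p "fst l" "snd l"])
    show "V z0 > 0" using V_ge[of z0] V(5) by simp
    show "\<xi> = 0" if "J z0 *v \<xi> = 0" for \<xi>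
      using elliptic[of \<xi> z0] that J_elliptic(1) by (auto simp: mult_le_0_iff)
    have "fst l \<bullet> mat 1 + snd l - 1 = 0"
      by (rule exact) (use X in \<open>auto intro!: continuous_intros\<close>)
    then show "fst l \<bullet> mat 1 + snd l = 1" by simp
    show "?DJ z0 b \<bullet> fst l + (b \<bullet> grad V z0) * snd l = 0" if "b \<in> Basis" for b
      by (rule exact) (use X that in \<open>auto intro!: continuous_intros\<close>)
    fix a b :: "real^'n" assume ab: "a \<in> Basis" "b \<in> Basis"
    have "(J z0 *v a) \<bullet> (fst l *v b) - (a \<bullet> b) * (1/2 - 1 / (p + 1)) * (J z0 \<bullet> fst l + V z0 * snd l) = 0"
      by (rule exact) (intro continuous_intros, use X ab in blast)
    then show "(J z0 *v a) \<bullet> (fst l *v b) = (a \<bullet> b) * (1/2 - 1 / (p + 1)) * (J z0 \<bullet> fst l + V z0 * snd l)"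
      by simp
  qed (use V J p in auto)
qed

end
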